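(* Let $t \geq 2$ be an integer. For $n \geq 1$ let $$a^*_t(n) := \sum_{\lambda \in \mathcal{SC}(n)} n_t(\lambda), \qquad b^*_t(n) := \sum_{\lambda \in \mathcal{DO}(n)} n_t(\lambda).$$ Then: (1) there exists an integer $N^*_t$ such that $a^*_t(n) \geq b^*_t(n)$ for all $n > N^*_t$; (2) there exists a constant $\gamma^*_t > 1$ such that $a^*_t(n)/b^*_t(n) \to \gamma^*_t$ as $n \to \infty$.
   Context: A partition $\lambda$ of $n$ is a non-increasing sequence of positive integers $\lambda_1 \ge \lambda_2 \ge \dots \ge \lambda_\ell$ summing to $n$. Its Ferrers–Young diagram has $\ell$ left-justified rows, row $i$ having $\lambda_i$ boxes. The hook number of the box in row $i$, column $j$ is $(\lambda_i - j) + (\lambda'_j - i) + 1$, where $\lambda'_j$ is the number of rows of length at least $j$ (i.e. the number of boxes to its right, plus the number below it, plus one). For $t \ge 1$, $n_t(\lambda)$ denotes the number of boxes of $\lambda$ with hook number exactly $t$. $\mathcal{SC}(n)$ is the set of self-conjugate partitions of $n$ (partitions whose diagram is symmetric about the main diagonal), and $\mathcal{DO}(n)$ is the set of partitions of $n$ into distinct odd parts. *)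

theory Defs
  imports Complex_Main
begin

text \<open>A partition is the list of its parts in non-increasing order.\<close>

definition partitions :: "nat \<Rightarrow> nat list set" where
  "partitions n = {l. sorted_wrt (\<ge>) l \<and> (\<forall>p\<in>set l. 0 < p) \<and> sum_list l = n}"

text \<open>Rows and columns are numbered from 0: the box \<open>(i, j)\<close> below is the box in row
  \<open>i + 1\<close> and column \<open>j + 1\<close> of the Ferrers-Young diagram.\<close>

definition diagram :: "nat list \<Rightarrow> (nat \<times> nat) set" where
  "diagram l = {(i, j). i < length l \<and> j < l ! i}"

definition col_length :: "nat list \<Rightarrow> nat \<Rightarrow> nat" where
  "col_length l j = card {i. i < length l \<and> j < l ! i}"

text \<open>The hook number is only meaningful for boxes of the diagram of a partition, where no
  subtraction truncates: there \<open>j + 1 \<le> l ! i\<close> and \<open>i + 1 \<le> col_length l j\<close>.\<close>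

definition hook :: "nat list \<Rightarrow> nat \<times> nat \<Rightarrow> nat" where
  "hook l = (\<lambda>(i, j). (l ! i - (j + 1)) + (col_length l j - (i + 1)) + 1)"

definition hook_count :: "nat \<Rightarrow> nat list \<Rightarrow> nat" where
  "hook_count t l = card {x \<in> diagram l. hook l x = t}"

definition SC :: "nat \<Rightarrow> nat list set" where
  "SC n = {l \<in> partitions n. sym (diagram l)}"

definition DO :: "nat \<Rightarrow> nat list set" where
  "DO n = {l \<in> partitions n. distinct l \<and> (\<forall>p\<in>set l. odd p)}"

definition a_star :: "nat \<Rightarrow> nat \<Rightarrow> nat" where
  "a_star t n = (\<Sum>l\<in>SC n. hook_count t l)"

definition b_star :: "nat \<Rightarrow> nat \<Rightarrow> nat" where
  "b_star t n = (\<Sum>l\<in>DO n. hook_count t l)"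

text \<open>The index sets of the sums and the sets being counted are finite.\<close>

lemma finite_partitions: "finite (partitions n)"
proof (rule finite_subset)
  have len: "length l \<le> sum_list l" if "\<forall>p\<in>set l. 0 < p" for l :: "nat list"
    using that by (induction l) auto
  show "partitions n \<subseteq> {l. set l \<subseteq> {..n} \<and> length l \<le> n}"
    using len by (auto simp: partitions_def intro: member_le_sum_list)
  show "finite {l. set l \<subseteq> {..n} \<and> length l \<le> n}"
    by (rule finite_lists_length_le) simp
qed

lemma finite_SC: "finite (SC n)" and finite_DO: "finite (DO n)"
  using finite_partitions[of n] by (simp_all add: SC_def DO_def)

lemma finite_diagram: "finite (diagram l)"
proof -
  have "diagram l = (SIGMA i:{..<length l}. {..<l ! i})"
    by (auto simp: diagram_def)
  then show ?thesis by simp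
qed

end

theory Submission
  imports Defs "HOL-Analysis.Elementary_Normed_Spaces"
begin

text \<open>Both \<open>SC n\<close> and \<open>DO n\<close> are indexed by the sets \<open>S\<close> of positive integers with
  \<open>(\<Sum>k\<in>S. 2 * k - 1) = n\<close> (diagonal hooks, respectively parts), and up to an error of at most
  \<open>t\<close> both hook counts are sums over \<open>k \<in> S\<close> of a function of \<open>S \<inter> {k - t..<k}\<close>. In the model
  where \<open>k \<in> S\<close> independently with probability \<open>1 / (1 + exp ((2 * k - 1) * s))\<close>, the sets of size \<open>n\<close>
  are equally likely. Chebyshev's inequality and the quasi-monotonicity of the number of such sets
  show that, for suitable \<open>s\<close> with \<open>n * s\<^sup>2\<close> bounded, size \<open>n\<close> has probability at least
  \<open>exp (- O(s powr (-1/2)))\<close>. The exponential moments of the local sums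
  then force their mean over the sets of size \<open>n\<close> to agree with the unconditioned mean up to
  \<open>o(1 / s)\<close>, and Riemann sums evaluate the latter. Multiplied by \<open>s\<close>, the mean tends to \<open>1 / 2\<close>
  for \<open>SC n\<close>; for \<open>DO n\<close> it tends to a positive limit that is at most \<open>ln 2 / 2\<close>, since the number of hooks
  of length \<open>t\<close> is at most the number of parts.\<close>

section \<open>Independent random subsets\<close>

text \<open>A crude lower bound for the probability of size \<open>n\<close> suffices because the
  error budget is wide. With \<open>s = 1 / x ^ 4\<close> the sums under study have order
  \<open>x ^ 4\<close>, whereas conditioning on an event of probability at least
  \<open>exp (- 24 * x\<^sup>2)\<close> costs only \<open>24 * x\<^sup>2\<close> in the exponent.
  Exponential moments at \<open>\<theta> = 1 / x\<close> and \<open>\<theta> = - 1 / x\<close>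
  convert this cost into an error of order \<open>x ^ 3\<close> in the mean, and their second-order
  term has the same order. The obstacle is that the windows of neighbouring \<open>k\<close>
  overlap; residue classes modulo \<open>t + 1\<close> separate them, at the price of a factor
  \<open>t + 1\<close> in the error. The limit \<open>1 / 2\<close> for \<open>SC n\<close> does not
  depend on \<open>t\<close>: the hooks come in mirror pairs, apart from at most \<open>t\<close> of
  them, and each pair amounts to a \<open>k\<close> in \<open>S\<close> with \<open>k - t\<close>
  absent. The density of such \<open>k\<close> is \<open>p * (1 - p)\<close>, minus the derivative
  of the Fermi function, so its integral is elementary. The bound for \<open>DO n\<close> separates
  the two limits because \<open>ln 2 < 1\<close>.\<close>

text \<open>The elements of the random subset \<open>S\<close> of \<open>A\<close> are chosen independently, \<open>k\<close> with
  probability \<open>p k\<close>.\<close>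

definition expect :: "'a set \<Rightarrow> ('a \<Rightarrow> real) \<Rightarrow> ('a set \<Rightarrow> real) \<Rightarrow> real" where
  "expect A p F = (\<Sum>S\<in>Pow A. prod p S * (\<Prod>k\<in>A - S. 1 - p k) * F S)"

lemma expect_cong:
  assumes "\<And>S. S \<subseteq> A \<Longrightarrow> F S = G S"
  shows "expect A p F = expect A p G"
  unfolding expect_def using assms by (intro sum.cong) auto

lemma expect_empty [simp]: "expect {} p F = F {}"
  by (simp add: expect_def)

lemma expect_insert:
  assumes "finite A" "a \<notin> A"
  shows "expect (insert a A) p F = (1 - p a) * expect A p F + p a * expect A p (\<lambda>S. F (insert a S))"
proof -
  have inj: "inj_on (insert a) (Pow A)"
    using assms(2) by (force simp: inj_on_def)
  have "expect (insert a A) p F =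
      (\<Sum>S\<in>Pow A. prod p S * (\<Prod>k\<in>insert a A - S. 1 - p k) * F S) +
      (\<Sum>S\<in>Pow A. prod p (insert a S) * (\<Prod>k\<in>insert a A - insert a S. 1 - p k) * F (insert a S))"
    unfolding expect_def Pow_insert using assms
    by (subst sum.union_disjoint) (auto simp: sum.reindex[OF inj])
  also have "(\<Sum>S\<in>Pow A. prod p S * (\<Prod>k\<in>insert a A - S. 1 - p k) * F S) = (1 - p a) * expect A p F"
    unfolding expect_def sum_distrib_left
  proof (intro sum.cong refl)
    fix S assume S: "S \<in> Pow A"
    then have "insert a A - S = insert a (A - S)" using assms(2) by auto
    then show "prod p S * (\<Prod>k\<in>insert a A - S. 1 - p k) * F S =
        (1 - p a) * (prod p S * (\<Prod>k\<in>A - S. 1 - p k) * F S)"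
      using assms by simp
  qed
  also have "(\<Sum>S\<in>Pow A. prod p (insert a S) * (\<Prod>k\<in>insert a A - insert a S. 1 - p k) * F (insert a S))
      = p a * expect A p (\<lambda>S. F (insert a S))"
    unfolding expect_def sum_distrib_left
  proof (intro sum.cong refl)
    fix S assume S: "S \<in> Pow A"
    then have "insert a A - insert a S = A - S" "a \<notin> S" "finite S"
      using assms finite_subset by auto
    then show "prod p (insert a S) * (\<Prod>k\<in>insert a A - insert a S. 1 - p k) * F (insert a S) =
        p a * (prod p S * (\<Prod>k\<in>A - S. 1 - p k) * F (insert a S))"
      by simp
  qed
  finally show ?thesis .
qed

lemma expect_add: "expect A p (\<lambda>S. F S + G S) = expect A p F + expect A p G"
  by (simp add: expect_def algebra_simps sum.distrib)

lemma expect_cmult: "expect A p (\<lambda>S. c * F S) = c * expect A p F"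
  by (simp add: expect_def algebra_simps sum_distrib_left)

lemma expect_const: "finite A \<Longrightarrow> expect A p (\<lambda>S. c) = c"
  by (induction A rule: finite_induct) (auto simp: expect_insert algebra_simps)

text \<open>The two claims share one induction: in the step the centred sum is shifted by
  \<open>c a * (1 - p a)\<close> or by \<open>- (c a * p a)\<close>, and the cross term with the old
  sum drops out because its mean is known to be 0.\<close>

lemma expect_variance:
  assumes "finite A"
  shows "expect A p (\<lambda>S. (sum c S - (\<Sum>k\<in>A. c k * p k))\<^sup>2) = (\<Sum>k\<in>A. (c k)\<^sup>2 * (p k * (1 - p k)))"
    and "expect A p (\<lambda>S. sum c S - (\<Sum>k\<in>A. c k * p k)) = 0"
  using assms
proof (induction A rule: finite_induct)
  case (insert a A)
  define Z where "Z = (\<lambda>S. sum c S - (\<Sum>k\<in>A. c k * p k))"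
  have Z0: "expect A p Z = 0" and Z2: "expect A p (\<lambda>S. (Z S)\<^sup>2) = (\<Sum>k\<in>A. (c k)\<^sup>2 * (p k * (1 - p k)))"
    using insert unfolding Z_def by auto
  have shift: "expect A p (\<lambda>S. sum c (insert a S) - (\<Sum>k\<in>insert a A. c k * p k)) =
      expect A p (\<lambda>S. Z S + c a * (1 - p a))"
    using insert.hyps finite_subset
    by (intro expect_cong) (subst sum.insert; force simp: Z_def algebra_simps)
  have shift2: "expect A p (\<lambda>S. (sum c (insert a S) - (\<Sum>k\<in>insert a A. c k * p k))\<^sup>2) =
      expect A p (\<lambda>S. (Z S)\<^sup>2 + (2 * (c a * (1 - p a)) * Z S + (c a * (1 - p a))\<^sup>2))"
  proof (intro expect_cong)
    fix S assume "S \<subseteq> A"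
    then have "sum c (insert a S) = c a + sum c S"
      using insert.hyps finite_subset by (subst sum.insert) auto
    then show "(sum c (insert a S) - (\<Sum>k\<in>insert a A. c k * p k))\<^sup>2 =
      (Z S)\<^sup>2 + (2 * (c a * (1 - p a)) * Z S + (c a * (1 - p a))\<^sup>2)"
      using insert.hyps by (simp add: Z_def power2_eq_square algebra_simps)
  qed
  have stay: "(\<lambda>S. sum c S - (\<Sum>k\<in>insert a A. c k * p k)) = (\<lambda>S. Z S + - (c a * p a))"
    using insert.hyps by (auto simp: Z_def algebra_simps)
  have stay2: "(\<lambda>S. (sum c S - (\<Sum>k\<in>insert a A. c k * p k))\<^sup>2) =
     (\<lambda>S. (Z S)\<^sup>2 + (- 2 * (c a * p a) * Z S + (c a * p a)\<^sup>2))"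
    using insert.hyps by (auto simp: Z_def power2_eq_square algebra_simps)
  {
    case 1
    show ?case
      unfolding expect_insert[OF insert.hyps(1,2)] shift2 unfolding stay2 expect_add expect_cmult
      using insert.hyps Z2 by (simp add: Z0 expect_const power2_eq_square algebra_simps)
  next
    case 2
    show ?case
      unfolding expect_insert[OF insert.hyps(1,2)] shift unfolding stay expect_add
      using insert.hyps by (simp add: Z0 expect_const algebra_simps)
  }
qed auto

lemma expect_Un:
  assumes "finite A" "finite B" "A \<inter> B = {}"
  shows "expect (A \<union> B) p (\<lambda>S. F (S \<inter> A) * G (S \<inter> B)) = expect A p F * expect B p G"
  using assms(2,3)
\<comment> \<open>The function on the second block has to vary: choosing \<open>b\<close> replaces
  \<open>G\<close> by \<open>\<lambda>T. G (insert b T)\<close>.\<close>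
proof (induction B arbitrary: G rule: finite_induct)
  case empty
  have "expect A p (\<lambda>S. F (S \<inter> A) * G {}) = expect A p (\<lambda>S. G {} * F S)"
    by (intro expect_cong) (auto simp: Int_absorb2)
  then show ?case by (simp add: expect_cmult)
next
  case (insert b B)
  have b: "b \<notin> A \<union> B" "finite (A \<union> B)" using insert assms by auto
  have 1: "expect (A \<union> B) p (\<lambda>S. F (S \<inter> A) * G (S \<inter> insert b B)) =
      expect (A \<union> B) p (\<lambda>S. F (S \<inter> A) * G (S \<inter> B))"
  proof (intro expect_cong)
    fix S assume "S \<subseteq> A \<union> B"
    then have "S \<inter> insert b B = S \<inter> B" using b by auto
    then show "F (S \<inter> A) * G (S \<inter> insert b B) = F (S \<inter> A) * G (S \<inter> B)" by simp
  qed
  have 2: "expect (A \<union> B) p (\<lambda>S. F (insert b S \<inter> A) * G (insert b S \<inter> insert b B)) =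
      expect (A \<union> B) p (\<lambda>S. F (S \<inter> A) * G (insert b (S \<inter> B)))"
  proof (intro expect_cong)
    fix S assume "S \<subseteq> A \<union> B"
    then have "insert b S \<inter> A = S \<inter> A" "insert b S \<inter> insert b B = insert b (S \<inter> B)"
      using b by auto
    then show "F (insert b S \<inter> A) * G (insert b S \<inter> insert b B) = F (S \<inter> A) * G (insert b (S \<inter> B))"
      by simp
  qed
  have "A \<union> insert b B = insert b (A \<union> B)" by auto
  then have "expect (A \<union> insert b B) p (\<lambda>S. F (S \<inter> A) * G (S \<inter> insert b B)) =
      (1 - p b) * (expect A p F * expect B p G) + p b * (expect A p F * expect B p (\<lambda>T. G (insert b T)))"
    using insert.prems insert.IH[of G] insert.IH[of "\<lambda>T. G (insert b T)"]
    by (simp only: expect_insert[OF b(2,1)] 1 2) auto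
  then show ?case
    using insert.hyps by (simp add: expect_insert algebra_simps)
qed

lemma expect_restrict:
  assumes "finite A" "B \<subseteq> A"
  shows "expect A p (\<lambda>S. F (S \<inter> B)) = expect B p F"
proof -
  have "expect (B \<union> (A - B)) p (\<lambda>S. F (S \<inter> B) * (\<lambda>_. 1) (S \<inter> (A - B))) = expect B p F * expect (A - B) p (\<lambda>_. 1)"
    using assms finite_subset by (intro expect_Un) auto
  moreover have "B \<union> (A - B) = A" using assms by auto
  ultimately show ?thesis using assms by (simp add: expect_const)
qed

text \<open>Peel off one block: the product over the others is a function of the trace of
  \<open>S\<close> on their union \<open>U\<close>, hence independent of the first factor.\<close>

lemma expect_blocks:
  assumes "finite A" "finite C" "\<And>k. k \<in> C \<Longrightarrow> B k \<subseteq> A"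
    "\<And>i j. i \<in> C \<Longrightarrow> j \<in> C \<Longrightarrow> i \<noteq> j \<Longrightarrow> B i \<inter> B j = {}"
  shows "expect A p (\<lambda>S. \<Prod>k\<in>C. G k (S \<inter> B k)) = (\<Prod>k\<in>C. expect (B k) p (G k))"
  using assms(2-)
proof (induction C rule: finite_induct)
  case empty
  then show ?case using assms(1) by (simp add: expect_const)
next
  case (insert c C)
  define U where "U = (\<Union>k\<in>C. B k)"
  have U: "U \<subseteq> A" "B c \<inter> U = {}" "B c \<subseteq> A"
    using insert.prems insert.hyps unfolding U_def by fastforce+
  have fin: "finite U" "finite (B c)" using U assms(1) by (auto intro: finite_subset)
  have BU: "S \<inter> U \<inter> B k = S \<inter> B k" if "k \<in> C" for S k using that by (auto simp: U_def)
  have "expect A p (\<lambda>S. \<Prod>k\<in>insert c C. G k (S \<inter> B k)) =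
      expect A p (\<lambda>S. (\<lambda>T. G c (T \<inter> B c) * (\<lambda>T. \<Prod>k\<in>C. G k (T \<inter> B k)) (T \<inter> U)) (S \<inter> (B c \<union> U)))"
  proof (intro expect_cong)
    fix S
    have "S \<inter> (B c \<union> U) \<inter> B c = S \<inter> B c" "S \<inter> (B c \<union> U) \<inter> U = S \<inter> U" by auto
    then show "(\<Prod>k\<in>insert c C. G k (S \<inter> B k)) =
        (\<lambda>T. G c (T \<inter> B c) * (\<lambda>T. \<Prod>k\<in>C. G k (T \<inter> B k)) (T \<inter> U)) (S \<inter> (B c \<union> U))"
      using insert.hyps by (simp add: BU)
  qed
  also have "\<dots> = expect (B c \<union> U) p (\<lambda>T. G c (T \<inter> B c) * (\<lambda>T. \<Prod>k\<in>C. G k (T \<inter> B k)) (T \<inter> U))"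
    using U by (intro expect_restrict assms) auto
  also have "\<dots> = expect (B c) p (G c) * expect U p (\<lambda>T. \<Prod>k\<in>C. G k (T \<inter> B k))"
    using U fin by (intro expect_Un) auto
  also have "expect U p (\<lambda>T. \<Prod>k\<in>C. G k (T \<inter> B k)) = expect A p (\<lambda>S. \<Prod>k\<in>C. G k (S \<inter> B k))"
    using expect_restrict[OF assms(1) U(1), of p "\<lambda>T. \<Prod>k\<in>C. G k (T \<inter> B k)"] by (simp add: BU)
  finally show ?case using insert by simp
qed

section \<open>Self-conjugate partitions and partitions into distinct odd parts\<close>

definition strict_pos :: "nat list \<Rightarrow> bool" where
  "strict_pos ks \<longleftrightarrow> sorted_wrt (>) ks \<and> 0 \<notin> set ks"

text \<open>Rows past the last one have length 0, so that symmetry of the diagram is an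
  unconditional equivalence and the integers \<open>row l i - i\<close> fill up everything far
  enough to the left.\<close>

definition row :: "nat list \<Rightarrow> nat \<Rightarrow> nat" where
  "row l i = (if i < length l then l ! i else 0)"

text \<open>The self-conjugate partition whose diagonal hooks have arms \<open>k\<close> (corner included), hence
  hook numbers \<open>2 * k - 1\<close>: the first hook is wrapped around the partition built from the rest.\<close>

primrec nest_hooks :: "nat list \<Rightarrow> nat list" where
  "nest_hooks [] = []"
| "nest_hooks (k # ks) =
     k # map Suc (nest_hooks ks @ replicate (k - 1 - length (nest_hooks ks)) 0)"

lemma mem_diagram: "(i, j) \<in> diagram l \<longleftrightarrow> j < row l i"
  by (auto simp: diagram_def row_def)

lemma sym_diagram: "sym (diagram l) \<longleftrightarrow> (\<forall>i j. j < row l i \<longleftrightarrow> i < row l j)"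
  unfolding sym_def by (auto simp: mem_diagram)

lemma strict_pos_Cons: "strict_pos (k # ks) \<longleftrightarrow> 0 < k \<and> (\<forall>x\<in>set ks. x < k) \<and> strict_pos ks"
  by (auto simp: strict_pos_def)

lemma length_nest_hooks:
  "strict_pos ks \<Longrightarrow> length (nest_hooks ks) = (case ks of [] \<Rightarrow> 0 | k # _ \<Rightarrow> k)"
  by (induction ks) (auto simp: strict_pos_Cons split: list.splits)

lemma length_nest_hooks_less: "strict_pos (k # ks) \<Longrightarrow> length (nest_hooks ks) < k"
  using length_nest_hooks[of ks] by (auto simp: strict_pos_Cons split: list.splits)

lemma row_nest_hooks_Cons:
  assumes "strict_pos (k # ks)"
  shows "row (nest_hooks (k # ks)) 0 = k"
    "row (nest_hooks (k # ks)) (Suc i) = (if Suc i < k then Suc (row (nest_hooks ks) i) else 0)"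
  using length_nest_hooks_less[OF assms] by (auto simp: row_def nth_append)

lemma sum_list_map_Suc: "sum_list (map Suc xs) = length xs + sum_list xs"
  by (induction xs) auto

lemma sum_nest_hooks: "strict_pos ks \<Longrightarrow> sum_list (nest_hooks ks) = (\<Sum>k\<leftarrow>ks. 2 * k - 1)"
proof (induction ks)
  case (Cons k ks)
  then show ?case
    using length_nest_hooks_less[of k ks] by (auto simp: strict_pos_Cons sum_list_map_Suc sum_list_replicate)
qed auto

lemma sorted_nest_hooks:
  "strict_pos ks \<Longrightarrow> sorted_wrt (\<ge>) (nest_hooks ks) \<and> (\<forall>p\<in>set (nest_hooks ks). 0 < p)"
proof (induction ks)
  case (Cons k ks)
  have le: "x \<le> length (nest_hooks ks)" if "x \<in> set (nest_hooks ks)" for x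
    using that Cons length_nest_hooks[of ks] by (cases ks) (auto simp: strict_pos_Cons)
  have lt: "length (nest_hooks ks) < k" using length_nest_hooks_less[OF Cons.prems] .
  have IH: "sorted_wrt (\<ge>) (nest_hooks ks)" using Cons by (simp add: strict_pos_Cons)
  have const: "sorted_wrt (\<ge>) (replicate m c)" for m and c :: nat by (induction m) auto
  have "sorted_wrt (\<ge>) (map Suc (nest_hooks ks @ replicate (k - 1 - length (nest_hooks ks)) 0))"
    using IH const by (auto simp: sorted_wrt_map sorted_wrt_append)
  moreover have "x < k" if "x \<in> set (nest_hooks ks)" for x
    using le[OF that] lt by simp
  ultimately show ?case using lt by (auto simp: Suc_le_eq)
qed auto

lemma sym_nest_hooks: "strict_pos ks \<Longrightarrow> sym (diagram (nest_hooks ks))"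
proof (induction ks)
  case (Cons k ks)
  then have IH: "j < row (nest_hooks ks) i \<longleftrightarrow> i < row (nest_hooks ks) j" for i j
    by (simp add: strict_pos_Cons sym_diagram)
  have 0: "row (nest_hooks ks) i = 0" if "\<not> Suc i < k" for i
    using length_nest_hooks_less[OF Cons.prems] that by (auto simp: row_def)
  have 1: "\<not> i < row (nest_hooks ks) j" if "\<not> Suc i < k" for i j
    using IH[of j i] 0[OF that] by simp
  have "j < row (nest_hooks (k # ks)) i \<longleftrightarrow> i < row (nest_hooks (k # ks)) j" for i j
    using Cons.prems row_nest_hooks_Cons[OF Cons.prems] IH 0 1
    by (cases i; cases j) (auto simp: strict_pos_Cons simp del: nest_hooks.simps)
  then show ?case by (simp add: sym_diagram)
qed (auto simp: sym_diagram row_def)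

lemma filter_pos_pad:
  fixes xs :: "nat list"
  assumes "sorted_wrt (\<ge>) xs"
  shows "filter ((<) 0) xs @ replicate (length xs - length (filter ((<) 0) xs)) 0 = xs"
  using assms
proof (induction xs)
  case (Cons x xs)
  show ?case
  proof (cases "x = 0")
    case True
    then have "\<forall>y\<in>set (x # xs). y = 0" using Cons.prems by auto
    then show ?thesis by (simp add: filter_empty_conv[THEN iffD2] replicate_length_same)
  qed (use Cons in auto)
qed auto

lemma row_append_zeros: "row (xs @ replicate m 0) i = row xs i"
  by (auto simp: row_def nth_append)

text \<open>Strong induction that strips the outer hook: drop the first row, subtract one from the
  others and discard the zeros. By symmetry the first part \<open>k\<close> is the number of rows,
  so the discarded zeros are exactly those that \<open>nest_hooks\<close> pads with.\<close>

lemma ex_nest_hooks: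
  assumes "sorted_wrt (\<ge>) l" "\<forall>p\<in>set l. 0 < p" "sym (diagram l)"
  shows "\<exists>ks. strict_pos ks \<and> nest_hooks ks = l"
  using assms
proof (induction "length l" arbitrary: l rule: less_induct)
  case less
  show ?case
  proof (cases l)
    case Nil
    then show ?thesis by (intro exI[of _ "[]"]) (auto simp: strict_pos_def)
  next
    case l: (Cons k rest)
    have symm: "j < row l i \<longleftrightarrow> i < row l j" for i j using less.prems by (simp add: sym_diagram)
    have "i < length l \<longleftrightarrow> i < k" for i
      using symm[of 0 i] less.prems(2) nth_mem[of i l] l by (auto simp: row_def split: if_splits)
    then have k: "length l = k" by (meson nat_neq_iff)
    define xs where "xs = map (\<lambda>x. x - 1) rest"
    define \<mu> where "\<mu> = filter ((<) 0) xs"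
    have srt: "sorted_wrt (\<ge>) xs"
      using less.prems(1) l unfolding xs_def sorted_wrt_map
      by (auto elim!: sorted_wrt_mono_rel[rotated])
    have pad: "\<mu> @ replicate (length xs - length \<mu>) 0 = xs"
      unfolding \<mu>_def by (rule filter_pos_pad[OF srt])
    have rowmu: "row \<mu> i = row l (Suc i) - 1" for i
      using row_append_zeros[of \<mu> "length xs - length \<mu>" i] unfolding pad
      by (auto simp: l row_def xs_def)
    have "sym (diagram \<mu>)"
      unfolding sym_diagram rowmu
    proof (intro allI)
      fix i j
      show "j < row l (Suc i) - 1 \<longleftrightarrow> i < row l (Suc j) - 1"
        using symm[of "Suc j" "Suc i"] by linarith
    qed
    moreover have "sorted_wrt (\<ge>) \<mu>" unfolding \<mu>_def by (rule sorted_wrt_filter[OF srt])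
    moreover have "\<forall>p\<in>set \<mu>. 0 < p" by (auto simp: \<mu>_def)
    moreover have len: "length \<mu> < k"
    proof -
      have "length \<mu> \<le> length xs" unfolding \<mu>_def by (rule length_filter_le)
      then show ?thesis using k l by (auto simp: xs_def)
    qed
    ultimately obtain ks where ks: "strict_pos ks" "nest_hooks ks = \<mu>"
      using less.hyps[of \<mu>] k by auto
    have "strict_pos (k # ks)"
      using ks length_nest_hooks[of ks] len by (cases ks) (auto simp: strict_pos_Cons)
    moreover have "nest_hooks (k # ks) = l"
    proof -
      have "map Suc xs = rest"
        using less.prems(2) l by (auto simp: xs_def intro!: map_idI)
      moreover have "k - 1 = length xs" using k l by (simp add: xs_def)
      ultimately show ?thesis using ks pad l by (simp del: map_append)
    qed
    ultimately show ?thesis by blast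
  qed
qed

section \<open>Hook numbers of self-conjugate partitions\<close>

text \<open>The numbers \<open>row l i - i\<close> are the positions of the vertical steps of the boundary path.
  Self-conjugacy makes \<open>z\<close> such a position iff \<open>1 - z\<close> is not.\<close>

lemma range_content_nest_hooks:
  assumes "strict_pos ks"
  shows "(\<exists>i. int (row (nest_hooks ks) i) - int i = z) \<longleftrightarrow>
    (if 0 < z then nat z \<in> set ks else nat (1 - z) \<notin> set ks)"
  using assms
proof (induction ks arbitrary: z)
  case Nil
  have "(\<exists>i. - int i = z) \<longleftrightarrow> z \<le> 0" by (auto intro: exI[of _ "nat (- z)"])
  then show ?case by (simp add: row_def)
next
  case (Cons k ks)
  let ?r = "row (nest_hooks (k # ks))" and ?r' = "row (nest_hooks ks)"
  have k: "0 < k" "\<And>x. x \<in> set ks \<Longrightarrow> x < k" "strict_pos ks"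
    using Cons.prems by (auto simp: strict_pos_Cons)
  have r: "?r 0 = k" "\<And>i. ?r (Suc i) = (if Suc i < k then Suc (?r' i) else 0)"
    using row_nest_hooks_Cons[OF Cons.prems] by auto
  have 0: "?r' i = 0" if "\<not> Suc i < k" for i
    using length_nest_hooks_less[OF Cons.prems] that by (auto simp: row_def)
  have "(\<exists>i. int (?r i) - int i = z) \<longleftrightarrow> z = int k \<or> (\<exists>i. int (?r (Suc i)) - int (Suc i) = z)"
    using r(1) by (metis (no_types, lifting) diff_zero nat.exhaust of_nat_0)
  \<comment> \<open>Wrapping a hook shifts the length and the index of each inner row together, so
    \<open>row l i - i\<close> persists. The net change of the range is that \<open>k\<close>
    appears and \<open>1 - k\<close> disappears.\<close>
  also have "(\<exists>i. int (?r (Suc i)) - int (Suc i) = z) \<longleftrightarrow>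
      (1 - int k < z \<and> (\<exists>i. int (?r' i) - int i = z)) \<or> z \<le> - int k" (is "?L \<longleftrightarrow> ?R")
  proof
    assume ?L
    then obtain i where i: "int (?r (Suc i)) - int (Suc i) = z" by blast
    then show ?R by (cases "Suc i < k") (auto simp: r(2) simp del: nest_hooks.simps)
  next
    assume ?R
    then show ?L
    proof (elim disjE conjE exE)
      fix i assume i: "1 - int k < z" "int (?r' i) - int i = z"
      then have "Suc i < k" using 0[of i] by (cases "Suc i < k") auto
      then show ?L using i(2) by (intro exI[of _ i]) (simp add: r(2) del: nest_hooks.simps)
    next
      assume "z \<le> - int k"
      moreover define i where "i = nat (- z - 1)"
      ultimately have "z = - int (Suc i)" "\<not> Suc i < k" using k(1) by auto
      then show ?L by (intro exI[of _ i]) (simp add: r(2) del: nest_hooks.simps)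
    qed
  qed
  also have "(\<exists>i. int (?r' i) - int i = z) \<longleftrightarrow>
      (if 0 < z then nat z \<in> set ks else nat (1 - z) \<notin> set ks)"
    using Cons.IH[OF k(3)] .
  finally show ?case using k(1) k(2)[of "nat (1 - z)"] by (cases "1 - z = int k") auto
qed

lemma sorted_row: "sorted_wrt (\<ge>) l \<Longrightarrow> i \<le> j \<Longrightarrow> row l j \<le> row l i"
  by (cases "i = j") (auto simp: row_def sorted_wrt_iff_nth_less)

text \<open>Column \<open>j\<close> has length \<open>row l j\<close>, so a box satisfies
  \<open>hook l (i, j) = b i + b j - 1\<close>. Off the diagram \<open>j \<ge> row l i\<close> and
  \<open>i \<ge> row l j\<close> force \<open>b i + b j \<le> 0\<close>, so the equation
  \<open>b i + b j = t + 1\<close> already selects boxes; injectivity of \<open>b\<close> turns it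
  into a condition on the set \<open>C\<close>.\<close>

lemma hook_count_sym:
  assumes "sorted_wrt (\<ge>) l" "sym (diagram l)" "1 \<le> t"
    and C: "C = range (\<lambda>i. int (row l i) - int i)"
  shows "hook_count t l = card {z \<in> C. int t + 1 - z \<in> C}"
proof -
  define b where "b = (\<lambda>i. int (row l i) - int i)"
  have sym: "j < row l i \<longleftrightarrow> i < row l j" for i j using assms(2) by (simp add: sym_diagram)
  have "b j < b i" if "i < j" for i j
    using sorted_row[OF assms(1), of i j] that by (simp add: b_def)
  then have inj: "inj b" by (metis injI less_irrefl linorder_neqE_nat)
  have col: "col_length l j = row l j" for j
  proof -
    have "{i. i < length l \<and> j < l ! i} = {i. j < row l i}" by (auto simp: row_def)
    also have "\<dots> = {..<row l j}" using sym by auto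
    finally show ?thesis by (simp add: col_length_def)
  qed
  have "x \<in> diagram l \<and> hook l x = t \<longleftrightarrow> b (fst x) + b (snd x) = int t + 1" for x
  proof -
    obtain i j where x: "x = (i, j)" by fastforce
    show ?thesis
    proof (cases "j < row l i")
      case True
      then have "i < row l j" "l ! i = row l i" using sym[of j i] by (auto simp: row_def split: if_splits)
      then show ?thesis using True by (auto simp: x mem_diagram hook_def col b_def)
    next
      case False
      then show ?thesis using sym[of j i] by (auto simp: x mem_diagram b_def)
    qed
  qed
  then have "hook_count t l = card {x. b (fst x) + b (snd x) = int t + 1}"
    by (simp add: hook_count_def)
  also have "\<dots> = card {z \<in> C. int t + 1 - z \<in> C}"
  proof (rule bij_betw_same_card[of "b \<circ> fst"], rule bij_betw_imageI)
    show "inj_on (b \<circ> fst) {x. b (fst x) + b (snd x) = int t + 1}"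
      using inj by (auto simp: inj_on_def)
    show "(b \<circ> fst) ` {x. b (fst x) + b (snd x) = int t + 1} = {z \<in> C. int t + 1 - z \<in> C}"
      unfolding C b_def[symmetric]
    proof (intro equalityI subsetI)
      fix z assume "z \<in> {z \<in> range b. int t + 1 - z \<in> range b}"
      then obtain i j where "z = b i" "int t + 1 - z = b j" by blast
      then show "z \<in> (b \<circ> fst) ` {x. b (fst x) + b (snd x) = int t + 1}"
        by (intro image_eqI[of _ _ "(i, j)"]) auto
    next
      fix z assume "z \<in> (b \<circ> fst) ` {x. b (fst x) + b (snd x) = int t + 1}"
      then obtain i j where "z = b i" "b i + b j = int t + 1" by auto
      then show "z \<in> {z \<in> range b. int t + 1 - z \<in> range b}"
        by (auto intro!: image_eqI[of _ _ j])
    qed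
  qed
  finally show ?thesis .
qed

text \<open>For \<open>z > t\<close> the condition on \<open>z\<close> reads
  \<open>z \<in> set ks\<close> and \<open>z - t \<notin> set ks\<close>; reflecting
  \<open>z\<close> to \<open>t + 1 - z\<close> gives equally many \<open>z \<le> 0\<close>, whence
  the factor 2. The \<open>t\<close> values in between produce the error \<open>c\<close>.\<close>

lemma hook_count_nest_hooks:
  assumes "strict_pos ks" "1 \<le> t"
  shows "\<exists>c\<le>t. hook_count t (nest_hooks ks) = 2 * card {k \<in> set ks. t < k \<and> k - t \<notin> set ks} + c"
proof -
  define C where "C = range (\<lambda>i. int (row (nest_hooks ks) i) - int i)"
  define U where "U = {k \<in> set ks. t < k \<and> k - t \<notin> set ks}"
  define H where "H = {z \<in> C. int t + 1 - z \<in> C}"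
  have C: "z \<in> C \<longleftrightarrow> (if 0 < z then nat z \<in> set ks else nat (1 - z) \<notin> set ks)" for z
    unfolding C_def using range_content_nest_hooks[OF assms(1), of z] by (auto simp del: if_split)
  have zero: "0 \<notin> set ks" using assms(1) by (simp add: strict_pos_def)
  have H: "H = int ` U \<union> (\<lambda>k. int t + 1 - int k) ` U \<union> (H \<inter> {1..int t})"
  proof (intro equalityI subsetI)
    fix z assume z: "z \<in> H"
    consider "int t < z" | "z \<in> {1..int t}" | "z \<le> 0" by fastforce
    then show "z \<in> int ` U \<union> (\<lambda>k. int t + 1 - int k) ` U \<union> (H \<inter> {1..int t})"
    proof cases
      case 1
      then have "nat z \<in> U" using z
        by (auto simp: H_def U_def C nat_diff_distrib' algebra_simps split: if_splits)
      then show ?thesis using 1 by (auto intro!: image_eqI[of _ _ "nat z"])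
    next
      case 3
      have "nat (int t + 1 - z) - t = nat (1 - z)" using 3 by auto
      then have "nat (int t + 1 - z) \<in> U" using 3 z
        by (auto simp: H_def U_def C split: if_splits)
      then show ?thesis using 3 by (auto intro!: image_eqI[of _ _ "nat (int t + 1 - z)"])
    qed (use z in auto)
  next
    fix z assume z: "z \<in> int ` U \<union> (\<lambda>k. int t + 1 - int k) ` U \<union> (H \<inter> {1..int t})"
    have "int k \<in> C \<and> int t + 1 - int k \<in> C" if "k \<in> U" for k
    proof -
      have k: "k \<in> set ks" "t < k" "k - t \<notin> set ks" using that by (auto simp: U_def)
      have "nat (1 - (int t + 1 - int k)) = k - t" by auto
      then show ?thesis using k by (auto simp: C)
    qed
    then show "z \<in> H" using z by (auto simp: H_def)
  qed
  have fin: "finite U" by (simp add: U_def)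
  have "card H = card (int ` U \<union> (\<lambda>k. int t + 1 - int k) ` U) + card (H \<inter> {1..int t})"
    by (subst H, subst card_Un_disjoint) (use fin in \<open>auto simp: U_def\<close>)
  also have "card (int ` U \<union> (\<lambda>k. int t + 1 - int k) ` U) = card (int ` U) + card ((\<lambda>k. int t + 1 - int k) ` U)"
    by (subst card_Un_disjoint) (use fin in \<open>auto simp: U_def\<close>)
  also have "\<dots> = 2 * card U"
    by (subst (1 2) card_image) (auto simp: inj_on_def)
  finally have "card H = 2 * card U + card (H \<inter> {1..int t})" .
  moreover have "card (H \<inter> {1..int t}) \<le> card {1..int t}" by (intro card_mono) auto
  moreover have "hook_count t (nest_hooks ks) = card H"
    unfolding H_def using sorted_nest_hooks[OF assms(1)] sym_nest_hooks[OF assms(1)] assms(2) C_def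
    by (intro hook_count_sym) auto
  ultimately show ?thesis by (auto simp: U_def)
qed

section \<open>Both families indexed by sets of positive integers\<close>

definition desc :: "nat set \<Rightarrow> nat list" where
  "desc S = rev (sorted_list_of_set S)"

definition odd_size :: "nat set \<Rightarrow> nat" where
  "odd_size S = (\<Sum>k\<in>S. 2 * k - 1)"

definition odd_sets :: "nat \<Rightarrow> nat set set" where
  "odd_sets n = {S. finite S \<and> 0 \<notin> S \<and> odd_size S = n}"

lemma odd_setsD: "S \<in> odd_sets n \<Longrightarrow> finite S" "S \<in> odd_sets n \<Longrightarrow> k \<in> S \<Longrightarrow> 0 < k"
  by (auto simp: odd_sets_def intro: Nat.gr0I)

lemma desc: "finite S \<Longrightarrow> sorted_wrt (>) (desc S)" "finite S \<Longrightarrow> set (desc S) = S"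
  by (auto simp: desc_def sorted_wrt_rev)

lemma strict_pos_desc: "finite S \<Longrightarrow> 0 \<notin> S \<Longrightarrow> strict_pos (desc S)"
  by (auto simp: strict_pos_def desc)

lemma desc_set: "sorted_wrt (>) ks \<Longrightarrow> desc (set ks) = ks"
proof -
  assume "sorted_wrt (>) ks"
  then have "sorted_wrt (<) (rev ks)" by (simp add: sorted_wrt_rev)
  then have "sorted_list_of_set (set (rev ks)) = rev ks"
    by (subst sorted_list_of_set.idem_if_sorted_distinct) (auto simp: strict_sorted_iff)
  then show ?thesis by (simp add: desc_def)
qed

lemma sum_list_desc: "finite S \<Longrightarrow> sum_list (map f (desc S)) = sum f S"
  by (subst sum_list_distinct_conv_sum_set) (auto simp: desc_def)

text \<open>Injective because the positive values of \<open>row l i - i\<close> recover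
  \<open>S\<close>; surjective because every self-conjugate partition is a nest of hooks.\<close>

lemma bij_betw_SC: "bij_betw (\<lambda>S. nest_hooks (desc S)) (odd_sets n) (SC n)"
proof (rule bij_betw_imageI)
  have C: "(\<exists>i. int (row (nest_hooks (desc S)) i) - int i = int k) \<longleftrightarrow> k \<in> S"
    if "S \<in> odd_sets n" "0 < k" for S k
    using that range_content_nest_hooks[of "desc S" "int k"]
    by (auto simp: odd_sets_def strict_pos_desc desc)
  show "inj_on (\<lambda>S. nest_hooks (desc S)) (odd_sets n)"
  proof (rule inj_onI, rule set_eqI)
    fix S T k assume *: "S \<in> odd_sets n" "T \<in> odd_sets n" "nest_hooks (desc S) = nest_hooks (desc T)"
    then have "0 \<notin> S" "0 \<notin> T" by (auto simp: odd_sets_def)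
    then show "k \<in> S \<longleftrightarrow> k \<in> T" using C[OF *(1), of k] C[OF *(2), of k] *(3) by (cases "k = 0") auto
  qed
  show "(\<lambda>S. nest_hooks (desc S)) ` odd_sets n = SC n"
  proof (intro equalityI subsetI)
    fix l assume "l \<in> (\<lambda>S. nest_hooks (desc S)) ` odd_sets n"
    then obtain S where S: "finite S" "0 \<notin> S" "odd_size S = n" "l = nest_hooks (desc S)"
      by (auto simp: odd_sets_def)
    then show "l \<in> SC n"
      using sorted_nest_hooks[of "desc S"] sym_nest_hooks[of "desc S"] sum_nest_hooks[of "desc S"]
      by (auto simp: SC_def partitions_def strict_pos_desc sum_list_desc odd_size_def)
  next
    fix l assume l: "l \<in> SC n"
    then obtain ks where ks: "strict_pos ks" "nest_hooks ks = l"
      using ex_nest_hooks[of l] by (auto simp: SC_def partitions_def)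
    then have d: "desc (set ks) = ks" by (intro desc_set) (simp add: strict_pos_def)
    have "set ks \<in> odd_sets n"
      using ks l sum_nest_hooks[OF ks(1)] sum_list_desc[of "set ks" "\<lambda>k. 2 * k - 1"]
      by (auto simp: odd_sets_def odd_size_def SC_def partitions_def d strict_pos_def)
    then show "l \<in> (\<lambda>S. nest_hooks (desc S)) ` odd_sets n"
      using ks d by (intro image_eqI[of _ _ "set ks"]) auto
  qed
qed

lemma bij_betw_DO: "bij_betw (\<lambda>S. map (\<lambda>k. 2 * k - 1) (desc S)) (odd_sets n) (DO n)"
proof (rule bij_betw_imageI)
  let ?f = "\<lambda>k::nat. 2 * k - 1"
  have inj: "inj_on ?f {0<..}" by (auto simp: inj_on_def)
  show "inj_on (\<lambda>S. map ?f (desc S)) (odd_sets n)"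
  proof (rule inj_onI)
    fix S T assume *: "S \<in> odd_sets n" "T \<in> odd_sets n" "map ?f (desc S) = map ?f (desc T)"
    then have fin: "finite S" "finite T" and sub: "S \<subseteq> {0<..}" "T \<subseteq> {0<..}"
      using odd_setsD by (auto dest: odd_setsD)
    have "?f ` S = ?f ` T" using arg_cong[OF *(3), of set] fin by (simp add: desc)
    then show "S = T" using sub inj by (simp add: inj_on_image_eq_iff)
  qed
  show "(\<lambda>S. map ?f (desc S)) ` odd_sets n = DO n"
  proof (intro equalityI subsetI)
    fix l assume "l \<in> (\<lambda>S. map ?f (desc S)) ` odd_sets n"
    then obtain S where S: "finite S" "0 \<notin> S" "odd_size S = n" "l = map ?f (desc S)"
      by (auto simp: odd_sets_def)
    have pos: "0 < k" if "k \<in> S" for k using S(2) that by (cases k) auto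
    have sorted: "sorted_wrt (>) l"
      unfolding S(4) sorted_wrt_map
      using desc(1)[OF S(1)] by (rule sorted_wrt_mono_rel[rotated]) (use pos S(1) in \<open>auto simp: desc\<close>)
    then have "sorted_wrt (\<ge>) l" by (rule sorted_wrt_mono_rel[rotated]) auto
    moreover have "distinct l"
    proof -
      have "sorted_wrt (<) (rev l)" using sorted by (simp add: sorted_wrt_rev)
      then show ?thesis unfolding strict_sorted_iff by simp
    qed
    moreover have "\<forall>p\<in>set l. 0 < p \<and> odd p"
    proof
      fix p assume "p \<in> set l"
      then obtain k where k: "k \<in> S" "p = 2 * k - 1" using S(1) by (auto simp: S(4) desc)
      then obtain m where "k = Suc m" using pos gr0_implies_Suc by blast
      then show "0 < p \<and> odd p" using k(2) by simp
    qed
    moreover have "sum_list l = n" using S by (simp add: sum_list_desc odd_size_def)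
    ultimately show "l \<in> DO n" by (auto simp: DO_def partitions_def)
  next
    fix l assume l: "l \<in> DO n"
    define ks where "ks = map (\<lambda>p. (p + 1) div 2) l"
    have odd: "\<forall>p\<in>set l. odd p" and dist: "distinct l" and srt: "sorted_wrt (\<ge>) l"
      using l by (auto simp: DO_def partitions_def)
    have lks: "map ?f ks = l" using odd by (auto simp: ks_def intro!: map_idI elim!: oddE)
    have "sorted_wrt (>) l" using srt dist
      by (auto simp: sorted_wrt_iff_nth_less nth_eq_iff_index_eq order.order_iff_strict)
    then have "sorted_wrt (>) ks" unfolding ks_def sorted_wrt_map
      by (rule sorted_wrt_mono_rel[rotated]) (use odd in \<open>auto elim!: oddE\<close>)
    then have d: "desc (set ks) = ks" by (rule desc_set)
    have "0 \<notin> set ks" using odd by (auto simp: ks_def elim!: oddE)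
    moreover have "odd_size (set ks) = n"
      using sum_list_desc[of "set ks" ?f, unfolded d lks] l
      by (simp add: odd_size_def DO_def partitions_def)
    ultimately show "l \<in> (\<lambda>S. map ?f (desc S)) ` odd_sets n"
      using d lks by (intro image_eqI[of _ _ "set ks"]) (auto simp: odd_sets_def)
  qed
qed

section \<open>Hook numbers of partitions into distinct odd parts\<close>

text \<open>A hook of length \<open>t\<close> in the row of the part \<open>2 * k - 1\<close> ends in column \<open>2 * k - 1 - d\<close>
  (counted from 0) with \<open>d \<le> t\<close>, so it only depends on the presence of the parts
  \<open>2 * (k - i) - 1\<close> with \<open>1 \<le> i \<le> t\<close>.\<close>

definition window :: "nat \<Rightarrow> nat set \<Rightarrow> nat \<Rightarrow> nat set" where
  "window t S k = {i \<in> {1..t}. k - i \<in> S}"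

definition window_hook :: "nat \<Rightarrow> nat set \<Rightarrow> bool" where
  "window_hook t J \<longleftrightarrow> (\<exists>d\<ge>1. d + card {i \<in> J. 2 * i < d} = t)"

text \<open>The first summand is the arm plus one. All rows up to \<open>i\<close> reach column
  \<open>j\<close>, so the leg counts the smaller parts \<open>2 * k' - 1\<close> that exceed
  \<open>j\<close>, and \<open>2 * k' - 1 > j\<close> is the stated inequality in terms of the
  difference from \<open>desc S ! i\<close>.\<close>

lemma hook_odd_parts:
  assumes "finite S" "0 \<notin> S" and l: "l = map (\<lambda>k. 2 * k - 1) (desc S)"
    and "i < length l" "j < l ! i"
  shows "hook l (i, j) =
    (2 * desc S ! i - 1 - j) + card {k' \<in> S. k' < desc S ! i \<and> 2 * (desc S ! i - k') < 2 * desc S ! i - 1 - j}"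
proof -
  define k where "k = desc S ! i"
  have dec: "desc S ! b < desc S ! a" if "a < b" "b < length l" for a b
    using desc(1)[OF assms(1)] that by (auto simp: sorted_wrt_iff_nth_less l)
  have nth: "l ! a = 2 * desc S ! a - 1" if "a < length l" for a using that by (simp add: l)
  have "{i'. i' < length l \<and> j < l ! i'} = {..i} \<union> {i'. i < i' \<and> i' < length l \<and> j < l ! i'}"
  proof -
    have "j < l ! a" if "a \<le> i" for a
      using dec[of a i] that assms(4,5) nth[of a] nth[of i] by (cases "a = i") auto
    then show ?thesis using assms(4) by fastforce
  qed
  then have "col_length l j = card ({..i} \<union> {i'. i < i' \<and> i' < length l \<and> j < l ! i'})"
    by (simp add: col_length_def)
  also have "\<dots> = Suc i + card {i'. i < i' \<and> i' < length l \<and> j < l ! i'}"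
    by (subst card_Un_disjoint) auto
  also have "card {i'. i < i' \<and> i' < length l \<and> j < l ! i'} =
      card {k' \<in> S. k' < k \<and> 2 * (k - k') < 2 * k - 1 - j}"
  proof (rule bij_betw_same_card[of "(!) (desc S)"], rule bij_betw_imageI)
    show "inj_on ((!) (desc S)) {i'. i < i' \<and> i' < length l \<and> j < l ! i'}"
      using dec by (auto simp: inj_on_def) (metis less_irrefl linorder_neqE_nat)
    show "(!) (desc S) ` {i'. i < i' \<and> i' < length l \<and> j < l ! i'} =
        {k' \<in> S. k' < k \<and> 2 * (k - k') < 2 * k - 1 - j}"
    proof (intro equalityI subsetI)
      fix k' assume "k' \<in> (!) (desc S) ` {i'. i < i' \<and> i' < length l \<and> j < l ! i'}"
      then obtain a where a: "i < a" "a < length l" "j < l ! a" "k' = desc S ! a" by auto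
      moreover from a have "k' \<in> S" using desc(2)[OF assms(1)] nth_mem[of a "desc S"] by (auto simp: l)
      ultimately show "k' \<in> {k' \<in> S. k' < k \<and> 2 * (k - k') < 2 * k - 1 - j}"
        using dec[of i a] nth[of a] by (auto simp: k_def)
    next
      fix k' assume k': "k' \<in> {k' \<in> S. k' < k \<and> 2 * (k - k') < 2 * k - 1 - j}"
      then have "k' \<in> set (desc S)" using desc(2)[OF assms(1)] by simp
      then obtain a where a: "a < length l" "k' = desc S ! a"
        unfolding in_set_conv_nth l by auto
      have "i < a" using k' a dec[of a i] assms(4) by (cases "a = i"; cases "a < i") (auto simp: k_def)
      then show "k' \<in> (!) (desc S) ` {i'. i < i' \<and> i' < length l \<and> j < l ! i'}"
        using k' a nth[of a] by (auto intro!: image_eqI[of _ _ a])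
    qed
  qed
  finally have "col_length l j = Suc i + card {k' \<in> S. k' < k \<and> 2 * (k - k') < 2 * k - 1 - j}" .
  moreover have "hook l (i, j) = (l ! i - (j + 1)) + (col_length l j - (i + 1)) + 1"
    by (simp add: hook_def)
  ultimately show ?thesis
    using assms(5) nth[OF assms(4)] unfolding k_def[symmetric] by linarith
qed

text \<open>\<open>h k d\<close> increases strictly with \<open>d\<close>, so a row has at most one
  hook of length \<open>t\<close> and the hooks correspond to the rows that have one. For
  \<open>k > t\<close> the bound \<open>d \<le> t\<close> keeps the relevant parts inside the
  window; the rows with \<open>k \<le> t\<close> form the error.\<close>

lemma hook_count_odd_parts:
  assumes "finite S" "0 \<notin> S" and l: "l = map (\<lambda>k. 2 * k - 1) (desc S)"
  shows "\<exists>c\<le>t. hook_count t l = card {k \<in> S. t < k \<and> window_hook t (window t S k)} + c"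
proof -
  define h where "h k d = d + card {k' \<in> S. k' < k \<and> 2 * (k - k') < d}" for k d
  define X where "X = {k \<in> S. \<exists>d\<in>{1..2 * k - 1}. h k d = t}"
  have h_less: "h k d < h k d'" if "d < d'" for k d d'
    using that card_mono[of "{k' \<in> S. k' < k \<and> 2 * (k - k') < d'}" "{k' \<in> S. k' < k \<and> 2 * (k - k') < d}"]
      assms(1) by (force simp: h_def)
  have len: "length l = length (desc S)" by (simp add: l)
  have hook: "hook l (i, j) = h (desc S ! i) (2 * desc S ! i - 1 - j)" if "i < length l" "j < l ! i" for i j
    using hook_odd_parts[OF assms that] by (simp add: h_def)
  have dist: "distinct (desc S)" by (simp add: desc_def)
  have "hook_count t l = card X"
    unfolding hook_count_def
  proof (rule bij_betw_same_card[of "\<lambda>x. desc S ! fst x"], rule bij_betw_imageI)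
    show "inj_on (\<lambda>x. desc S ! fst x) {x \<in> diagram l. hook l x = t}"
    proof (rule inj_onI, clarify)
      fix i j i' j'
      assume *: "(i, j) \<in> diagram l" "(i', j') \<in> diagram l"
        "desc S ! fst (i, j) = desc S ! fst (i', j')" "t = hook l (i, j)" "hook l (i', j') = hook l (i, j)"
      then have ij: "i < length l" "j < l ! i" "i' < length l" "j' < l ! i'" by (auto simp: diagram_def)
      then have ii: "i = i'" using *(3) dist by (simp add: nth_eq_iff_index_eq len)
      have "2 * desc S ! i - 1 - j = 2 * desc S ! i - 1 - j'"
        using *(5) hook[OF ij(1,2)] hook[OF ij(3,4)] h_less ii by (metis linorder_neqE_nat less_irrefl)
      then show "i = i' \<and> j = j'" using ij ii by (auto simp: l)
    qed
    show "(\<lambda>x. desc S ! fst x) ` {x \<in> diagram l. hook l x = t} = X"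
    proof (intro equalityI subsetI)
      fix k assume "k \<in> (\<lambda>x. desc S ! fst x) ` {x \<in> diagram l. hook l x = t}"
      then obtain i j where ij: "i < length l" "j < l ! i" "hook l (i, j) = t" "k = desc S ! i"
        by (auto simp: diagram_def)
      then have "k \<in> S" using desc(2)[OF assms(1)] nth_mem[of i "desc S"] by (auto simp: len)
      moreover have "j < 2 * k - 1" using ij by (simp add: l)
      ultimately show "k \<in> X" using ij hook[of i j] unfolding X_def
        by (auto intro!: bexI[of _ "2 * k - 1 - j"])
    next
      fix k assume "k \<in> X"
      then obtain d where k: "k \<in> S" "1 \<le> d" "d \<le> 2 * k - 1" "h k d = t" by (auto simp: X_def)
      then obtain i where i: "i < length l" "desc S ! i = k"
        using desc(2)[OF assms(1)] len by (metis in_set_conv_nth)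
      define j where "j = 2 * k - 1 - d"
      have "j < l ! i" using i k by (simp add: l j_def)
      moreover have "2 * k - 1 - j = d" using k by (simp add: j_def)
      ultimately show "k \<in> (\<lambda>x. desc S ! fst x) ` {x \<in> diagram l. hook l x = t}"
        using i k hook[of i j] by (intro image_eqI[of _ _ "(i, j)"]) (auto simp: diagram_def)
    qed
  qed
  also have "X = {k \<in> S. t < k \<and> window_hook t (window t S k)} \<union> (X \<inter> {1..t})"
  proof -
    have eqv: "(\<exists>d\<in>{1..2 * k - 1}. h k d = t) \<longleftrightarrow> window_hook t (window t S k)" if "t < k" for k
    proof -
      have eq: "h k d = d + card {i \<in> window t S k. 2 * i < d}" if "d \<le> t" for d
      proof -
        have "bij_betw (\<lambda>i. k - i) {i \<in> window t S k. 2 * i < d} {k' \<in> S. k' < k \<and> 2 * (k - k') < d}"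
          by (rule bij_betw_byWitness[of _ "\<lambda>i. k - i"]) (use that \<open>t < k\<close> in \<open>auto simp: window_def\<close>)
        then show ?thesis by (simp add: h_def bij_betw_same_card)
      qed
      have "d \<le> t" if "h k d = t" for d using that by (simp add: h_def)
      moreover have "d \<le> 2 * k - 1" if "d \<le> t" for d using that \<open>t < k\<close> by simp
      ultimately show ?thesis unfolding window_hook_def
        by (metis atLeastAtMost_iff eq le_add1)
    qed
    have "k \<in> {1..t}" if "k \<in> S" "\<not> t < k" for k
      using that assms(2) by (cases k) auto
    then show ?thesis unfolding X_def using eqv by blast
  qed
  also have "card \<dots> = card {k \<in> S. t < k \<and> window_hook t (window t S k)} + card (X \<inter> {1..t})"
    by (subst card_Un_disjoint) (use assms(1) in auto)
  finally have "hook_count t l = card {k \<in> S. t < k \<and> window_hook t (window t S k)} + card (X \<inter> {1..t})" .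
  moreover have "card (X \<inter> {1..t}) \<le> card {1..t}" by (intro card_mono) auto
  ultimately show ?thesis by auto
qed

section \<open>Quasi-monotonicity of the number of sets of a given odd size\<close>

lemma odd_sets_subset: "S \<in> odd_sets m \<Longrightarrow> m \<le> n \<Longrightarrow> S \<subseteq> {1..n}"
proof
  fix k assume *: "S \<in> odd_sets m" "m \<le> n" "k \<in> S"
  have "2 * k - 1 \<le> odd_size S"
    unfolding odd_size_def
    using *(3) odd_setsD(1)[OF *(1)] by (intro member_le_sum) auto
  moreover have "0 < k" using odd_setsD(2) *(1,3) .
  moreover have "odd_size S = m" using *(1) by (simp add: odd_sets_def)
  ultimately show "k \<in> {1..n}" using *(2) by auto
qed

lemma finite_odd_sets: "finite (odd_sets n)"
  using odd_sets_subset[of _ n n] by (intro finite_subset[of "odd_sets n" "Pow {1..n}"]) auto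

text \<open>Raise the largest element by one. It stays the largest, so the original set can be
  recovered; \<open>1 \<le> m\<close> excludes the empty set.\<close>

lemma card_odd_sets_shift:
  assumes "1 \<le> m"
  shows "card (odd_sets m) \<le> card (odd_sets (m + 2))"
proof (rule card_inj_on_le[of "\<lambda>S. insert (Suc (Max S)) (S - {Max S})"])
  have ne: "S \<noteq> {}" if "S \<in> odd_sets m" for S
    using that assms by (auto simp: odd_sets_def odd_size_def)
  have notin: "Suc (Max S) \<notin> S" if "S \<in> odd_sets m" for S
    using odd_setsD(1)[OF that] Max_ge not_less_eq_eq by blast
  have Max: "Max (insert (Suc (Max S)) (S - {Max S})) = Suc (Max S)" if "S \<in> odd_sets m" for S
    using odd_setsD(1)[OF that] by (intro Max_eqI) (auto simp: le_Suc_eq)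
  show "inj_on (\<lambda>S. insert (Suc (Max S)) (S - {Max S})) (odd_sets m)"
  proof (rule inj_onI)
    fix S T assume *: "S \<in> odd_sets m" "T \<in> odd_sets m"
      "insert (Suc (Max S)) (S - {Max S}) = insert (Suc (Max T)) (T - {Max T})"
    have M: "Max S = Max T" using Max[OF *(1)] Max[OF *(2)] *(3) by simp
    have "S - {Max S} = T - {Max S}"
    proof -
      have "R - {a} = insert (Suc a) (R - {a}) - {Suc a}" if "Suc a \<notin> R" for R a
        using that by auto
      then show ?thesis using notin[OF *(1)] notin[OF *(2)] *(3) M by metis
    qed
    moreover have "insert (Max S) (S - {Max S}) = S" "insert (Max S) (T - {Max S}) = T"
      using Max_in[OF odd_setsD(1) ne, of S] Max_in[OF odd_setsD(1) ne, of T] *(1,2)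
      by (simp_all add: M insert_absorb)
    ultimately show "S = T" by metis
  qed
  show "(\<lambda>S. insert (Suc (Max S)) (S - {Max S})) ` odd_sets m \<subseteq> odd_sets (m + 2)"
  proof clarify
    fix S assume S: "S \<in> odd_sets m"
    have fin: "finite S" and M: "Max S \<in> S" "0 < Max S"
      using odd_setsD[OF S] ne[OF S] by auto
    have "odd_size S = (2 * Max S - 1) + odd_size (S - {Max S})"
      unfolding odd_size_def using fin M(1) by (rule sum.remove)
    moreover have "odd_size (insert (Suc (Max S)) (S - {Max S})) = 2 * Suc (Max S) - 1 + odd_size (S - {Max S})"
      unfolding odd_size_def using fin notin[OF S] by (subst sum.insert) auto
    ultimately show "insert (Suc (Max S)) (S - {Max S}) \<in> odd_sets (m + 2)"
      using S M by (auto simp: odd_sets_def)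
  qed
qed (rule finite_odd_sets)

text \<open>Inserting or deleting the part 1 changes the parity of the size.\<close>

lemma card_odd_sets_flip:
  shows "card (odd_sets (Suc m)) \<le> card (odd_sets m) + card (odd_sets (m + 2))"
    and "card (odd_sets 0) \<le> card (odd_sets 1)"
proof -
  define f where "f S = (if 1 \<in> S then S - {1} else insert 1 S)" for S :: "nat set"
  have inj: "inj_on f A" for A
    by (rule inj_on_inverseI[of _ f]) (auto simp: f_def)
  have f: "(1 \<in> S \<and> Suc (odd_size (f S)) = odd_size S \<or> odd_size (f S) = Suc (odd_size S))
      \<and> finite (f S) \<and> 0 \<notin> f S" if "finite S" "0 \<notin> S" for S
  proof (cases "1 \<in> S")
    case True
    then have "odd_size S = 1 + odd_size (S - {1})"
      unfolding odd_size_def using that(1) by (subst sum.remove[of S 1]) auto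
    then show ?thesis using True that by (simp add: f_def)
  next
    case False
    then have "odd_size (insert 1 S) = 1 + odd_size S"
      unfolding odd_size_def using that(1) by (subst sum.insert) auto
    then show ?thesis using False that by (simp add: f_def)
  qed
  have "f S \<in> odd_sets m \<union> odd_sets (m + 2)" if "S \<in> odd_sets (Suc m)" for S
    using that f[of S] by (auto simp: odd_sets_def)
  then have "card (odd_sets (Suc m)) \<le> card (odd_sets m \<union> odd_sets (m + 2))"
    by (intro card_inj_on_le[OF inj]) (auto simp: finite_odd_sets)
  also have "\<dots> \<le> card (odd_sets m) + card (odd_sets (m + 2))" by (rule card_Un_le)
  finally show "card (odd_sets (Suc m)) \<le> card (odd_sets m) + card (odd_sets (m + 2))" .
  have "f S \<in> odd_sets 1" if "S \<in> odd_sets 0" for S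
    using that f[of S] by (auto simp: odd_sets_def)
  then show "card (odd_sets 0) \<le> card (odd_sets 1)"
    by (intro card_inj_on_le[OF inj]) (auto simp: finite_odd_sets)
qed

lemma card_odd_sets_shift_even: "1 \<le> m \<Longrightarrow> card (odd_sets m) \<le> card (odd_sets (m + 2 * j))"
proof (induction j)
  case (Suc j)
  then show ?case using card_odd_sets_shift[of "m + 2 * j"] by simp
qed simp

text \<open>Equal parity is covered by repeated shifts; for opposite parity one flip bounds by two
  neighbouring sizes, whence the factor 2. Since \<open>odd_sets 2\<close> is empty while
  \<open>odd_sets 0\<close> and \<open>odd_sets 1\<close> are not, the bound starts at 3.\<close>

lemma card_odd_sets_quasi_mono:
  assumes "m \<le> n" "3 \<le> n"
  shows "card (odd_sets m) \<le> 2 * card (odd_sets n)"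
proof -
  have even: "card (odd_sets a) \<le> card (odd_sets n)" if "1 \<le> a" "a \<le> n" "even (n - a)" for a
    using card_odd_sets_shift_even[OF that(1), of "(n - a) div 2"] that by simp
  have ge2: "card (odd_sets a) \<le> 2 * card (odd_sets n)" if a: "2 \<le> a" "a \<le> n" for a
  proof (cases "even (n - a)")
    case False
    then have "a < n" "even (n - Suc a)" using a by (auto simp: le_less)
    then have "card (odd_sets (Suc a)) \<le> card (odd_sets n)" using a by (intro even) auto
    moreover obtain b where b: "a = Suc b" "1 \<le> b" using a by (cases a) auto
    ultimately show ?thesis
      using card_odd_sets_flip(1)[of b] card_odd_sets_shift[OF b(2)] by simp
  qed (use even[of a] a in auto)
  have one: "card (odd_sets 1) \<le> 2 * card (odd_sets n)"
    using card_odd_sets_shift[of 1] ge2[of 3] assms(2) by (simp add: numeral_3_eq_3)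
  show ?thesis
    using ge2[OF _ assms(1)] one card_odd_sets_flip(2) by (cases "m = 0"; cases "m = 1") auto
qed

section \<open>The probability of a given size\<close>

text \<open>The weight of a set of odd size \<open>m\<close> is proportional to \<open>exp (- s * m)\<close>. Writing
  \<open>s = 1 / x ^ 4\<close> keeps all error terms below polynomial in \<open>x\<close>.\<close>

definition part_prob :: "real \<Rightarrow> nat \<Rightarrow> real" where
  "part_prob x k = 1 / (1 + exp ((2 * real k - 1) / x ^ 4))"

definition mean_size :: "real \<Rightarrow> nat \<Rightarrow> real" where
  "mean_size x n = (\<Sum>k=1..n. (2 * real k - 1) * part_prob x k)"

lemma part_prob_bounds: "0 < part_prob x k" "part_prob x k < 1"
  by (auto simp: part_prob_def add_pos_pos)

lemma part_prob_le_exp: "part_prob x k \<le> exp (- ((2 * real k - 1) / x ^ 4))"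
proof -
  have "1 / (1 + exp u) \<le> 1 / exp u" for u :: real by (intro divide_left_mono) (auto simp: add_pos_pos)
  then show ?thesis by (simp add: part_prob_def exp_minus inverse_eq_divide)
qed

lemma sum_exp_neg_le:
  assumes "0 < y"
  shows "(\<Sum>k=1..n. exp (- (real k * y))) \<le> 1 / (y::real)"
proof -
  have r: "0 < exp (- y)" "exp (- y) < 1" using assms by auto
  have "(\<Sum>k=1..n. exp (- (real k * y))) = (\<Sum>k=1..n. exp (- y) ^ k)"
    by (intro sum.cong) (auto simp: exp_of_nat_mult[symmetric])
  also have "\<dots> \<le> exp (- y) / (1 - exp (- y))"
    using r by (auto simp: sum_gp divide_simps)
  also have "\<dots> = 1 / (exp y - 1)" using r by (simp add: exp_minus field_simps)
  also have "\<dots> \<le> 1 / y"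
    using assms exp_ge_add_one_self[of y] by (intro divide_left_mono mult_pos_pos) linarith+
  finally show ?thesis .
qed

text \<open>Half of the decay \<open>exp (- u)\<close> absorbs the polynomial factor; since
  \<open>2 * k - 1 \<ge> k\<close>, the other half leaves a geometric series of sum at most
  \<open>2 * x ^ 4\<close>. The case \<open>d = 1\<close> serves the mean, \<open>d = 2\<close> the
  variance.\<close>

lemma sum_part_weight_le:
  assumes "0 < x" "\<And>u. 0 \<le> u \<Longrightarrow> u ^ d * exp (- u) \<le> c * exp (- (u / 2))" "0 \<le> c"
  shows "(\<Sum>k=1..n. (2 * real k - 1) ^ d * part_prob x k) \<le> 2 * c * x ^ (4 * d + 4)"
proof -
  have "(2 * real k - 1) ^ d * part_prob x k \<le> c * x ^ (4 * d) * exp (- (real k * (1 / (2 * x ^ 4))))"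
    if "k \<in> {1..n}" for k
  proof -
    define u where "u = (2 * real k - 1) / x ^ 4"
    have k: "1 \<le> real k" using that by auto
    have u: "0 \<le> u" using k assms(1) by (simp add: u_def)
    have "2 * real k - 1 = x ^ 4 * u" using assms(1) by (simp add: u_def)
    then have pow: "(2 * real k - 1) ^ d = x ^ (4 * d) * u ^ d"
      by (simp add: power_mult_distrib power_mult)
    have "(2 * real k - 1) ^ d * part_prob x k \<le> (2 * real k - 1) ^ d * exp (- u)"
      unfolding u_def using k by (intro mult_left_mono part_prob_le_exp) auto
    also have "\<dots> = x ^ (4 * d) * (u ^ d * exp (- u))" by (simp add: pow)
    also have "\<dots> \<le> x ^ (4 * d) * (c * exp (- (u / 2)))"
      using assms u by (intro mult_left_mono) auto
    also have "\<dots> \<le> x ^ (4 * d) * (c * exp (- (real k * (1 / (2 * x ^ 4)))))"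
      using assms k by (intro mult_left_mono) (auto simp: u_def field_simps)
    finally show ?thesis by (simp add: mult_ac)
  qed
  then have "(\<Sum>k=1..n. (2 * real k - 1) ^ d * part_prob x k) \<le>
      c * x ^ (4 * d) * (\<Sum>k=1..n. exp (- (real k * (1 / (2 * x ^ 4)))))"
    unfolding sum_distrib_left by (rule sum_mono)
  also have "\<dots> \<le> c * x ^ (4 * d) * (1 / (1 / (2 * x ^ 4)))"
    using assms by (intro mult_left_mono sum_exp_neg_le) auto
  finally show ?thesis by (simp add: power_add mult_ac)
qed

lemma mean_size_nonneg: "0 \<le> mean_size x n"
  unfolding mean_size_def using part_prob_bounds
  by (intro sum_nonneg mult_nonneg_nonneg) (auto simp: less_imp_le)

lemma mean_size_le:
  assumes "0 < x"
  shows "mean_size x n \<le> 4 * x ^ 8"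
proof -
  have "u ^ 1 * exp (- u) \<le> 2 * exp (- (u / 2))" for u :: real
  proof -
    have "u \<le> 2 * exp (u / 2)" using exp_ge_add_one_self[of "u / 2"] by linarith
    then have "u * exp (- u) \<le> 2 * exp (u / 2) * exp (- u)" by (intro mult_right_mono) auto
    also have "\<dots> = 2 * exp (- (u / 2))" by (simp flip: exp_add)
    finally show ?thesis by simp
  qed
  from sum_part_weight_le[OF assms this, of n] show ?thesis by (simp add: mean_size_def)
qed

lemma variance_size_le:
  assumes "0 < x"
  shows "(\<Sum>k=1..n. (2 * real k - 1)\<^sup>2 * part_prob x k) \<le> 16 * x ^ 12"
proof -
  have "u ^ 2 * exp (- u) \<le> 8 * exp (- (u / 2))" if "0 \<le> u" for u :: real
  proof -
    have "u\<^sup>2 \<le> 8 * exp (u / 2)"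
      using exp_lower_Taylor_quadratic[of "u / 2"] that by (simp add: power_divide)
    then have "u\<^sup>2 * exp (- u) \<le> 8 * exp (u / 2) * exp (- u)" by (intro mult_right_mono) auto
    also have "\<dots> = 8 * exp (- (u / 2))" by (simp flip: exp_add)
    finally show ?thesis by simp
  qed
  from sum_part_weight_le[OF assms this, of n] show ?thesis by simp
qed

text \<open>The standard deviation of the size is at most \<open>4 * x ^ 6\<close>. Putting \<open>n\<close> two of them above the
  mean makes the typical sizes at most \<open>n\<close>, where quasi-monotonicity applies.\<close>

definition saddle :: "nat \<Rightarrow> real \<Rightarrow> bool" where
  "saddle n x \<longleftrightarrow> 1 \<le> x \<and> 3 \<le> n \<and> real n = mean_size x n + 8 * x ^ 6"

lemma saddle_upper: "saddle n x \<Longrightarrow> real n \<le> 12 * x ^ 8"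
  using mean_size_le[of x n] power_increasing[of 6 8 x] by (simp add: saddle_def)

definition config_weight :: "real \<Rightarrow> nat \<Rightarrow> nat set \<Rightarrow> real" where
  "config_weight x n S = prod (part_prob x) S * (\<Prod>k\<in>{1..n} - S. 1 - part_prob x k)"

lemma expect_config_weight:
  "expect {1..n} (part_prob x) F = (\<Sum>S\<in>Pow {1..n}. config_weight x n S * F S)"
  by (simp add: expect_def config_weight_def)

lemma real_odd_size: "0 \<notin> S \<Longrightarrow> real (odd_size S) = (\<Sum>k\<in>S. 2 * real k - 1)"
proof -
  assume "0 \<notin> S"
  then have "real (2 * k - 1) = 2 * real k - 1" if "k \<in> S" for k
    using that by (cases k) auto
  then show ?thesis by (simp add: odd_size_def)
qed

text \<open>The odds \<open>p / (1 - p)\<close> of \<open>k\<close> are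
  \<open>exp (- ((2 * k - 1) / x ^ 4))\<close>, so their product over \<open>S\<close> depends only
  on the odd size.\<close>

lemma config_weight_eq:
  assumes "S \<subseteq> {1..n}"
  shows "config_weight x n S = (\<Prod>k=1..n. 1 - part_prob x k) * exp (- (real (odd_size S) / x ^ 4))"
proof -
  have "part_prob x k = (1 - part_prob x k) * exp (- ((2 * real k - 1) / x ^ 4))" for k
  proof -
    have "1 + exp u \<noteq> 0" for u :: real by (metis add_pos_pos exp_gt_zero less_irrefl zero_less_one)
    then show ?thesis by (simp add: part_prob_def exp_minus field_simps)
  qed
  then have "prod (part_prob x) S = (\<Prod>k\<in>S. 1 - part_prob x k) * (\<Prod>k\<in>S. exp (- ((2 * real k - 1) / x ^ 4)))"
    by (simp flip: prod.distrib)
  also have "(\<Prod>k\<in>S. exp (- ((2 * real k - 1) / x ^ 4))) = exp (- (real (odd_size S) / x ^ 4))"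
    using assms finite_subset[OF assms]
    by (subst real_odd_size) (auto simp: exp_sum[symmetric] sum_negf sum_divide_distrib)
  finally show ?thesis
    unfolding config_weight_def using prod.subset_diff[OF assms, of "\<lambda>k. 1 - part_prob x k"] by simp
qed

lemma config_weight_nonneg: "0 \<le> config_weight x n S"
  unfolding config_weight_def using part_prob_bounds
  by (intro mult_nonneg_nonneg prod_nonneg) (auto simp: less_imp_le)

text \<open>Chebyshev puts at least 3/4 of the mass on sizes between \<open>n - 2 * D\<close> and
  \<open>n\<close>. A set there weighs at most
  \<open>exp (2 * D / x ^ 4) = exp (16 * x\<^sup>2)\<close> times as much as a set of size
  \<open>n\<close>, and by quasi-monotonicity there are at most \<open>2 * (n + 1)\<close> times as
  many. The remaining 8 of the exponent 24 pays for that factor.\<close>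

lemma prob_size_ge:
  assumes "saddle n x"
  shows "exp (- 24 * x\<^sup>2) \<le> real (card (odd_sets n)) * ((\<Prod>k=1..n. 1 - part_prob x k) * exp (- (real n / x ^ 4)))"
    (is "_ \<le> ?P")
proof -
  have x: "1 \<le> x" "0 < x" and n: "3 \<le> n" and mean: "real n = mean_size x n + 8 * x ^ 6"
    using assms by (auto simp: saddle_def)
  define Z where "Z = (\<Prod>k=1..n. 1 - part_prob x k)"
  have Z: "0 < Z" unfolding Z_def using part_prob_bounds by (intro prod_pos) auto
  define c where "c k = 2 * real k - 1" for k
  define M where "M = mean_size x n"
  \<comment> \<open>Twice the bound \<open>4 * x ^ 6\<close> on the standard deviation: Chebyshev
    then loses \<open>16 * x ^ 12 / D\<^sup>2 = 1 / 4\<close>, and \<open>n = M + D\<close> is the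
    upper end of the range of sizes.\<close>
  define D where "D = 8 * x ^ 6"
  have D: "0 < D" using x by (simp add: D_def)
  let ?E = "expect {1..n} (part_prob x)"
  define good where "good = {S \<in> Pow {1..n}. \<bar>sum c S - M\<bar> \<le> D}"
  have var: "?E (\<lambda>S. (sum c S - M)\<^sup>2) \<le> 16 * x ^ 12"
  proof -
    have "?E (\<lambda>S. (sum c S - M)\<^sup>2) = (\<Sum>k=1..n. (c k)\<^sup>2 * (part_prob x k * (1 - part_prob x k)))"
      unfolding M_def mean_size_def c_def by (rule expect_variance) simp
    also have "\<dots> \<le> (\<Sum>k=1..n. (c k)\<^sup>2 * part_prob x k)"
      using part_prob_bounds[of x]
      by (intro sum_mono mult_left_mono) (auto simp: mult_le_cancel_left1 less_imp_le not_less)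
    also have "\<dots> \<le> 16 * x ^ 12" unfolding c_def by (rule variance_size_le[OF x(2)])
    finally show ?thesis .
  qed
  have "1 = ?E (\<lambda>S. 1)" by (simp add: expect_const)
  also have "\<dots> \<le> ?E (\<lambda>S. (if S \<in> good then 1 else 0) + (1 / D\<^sup>2) * (sum c S - M)\<^sup>2)"
    unfolding expect_config_weight
  proof (intro sum_mono mult_left_mono config_weight_nonneg)
    fix S assume S: "S \<in> Pow {1..n}"
    show "1 \<le> (if S \<in> good then 1 else 0) + (1 / D\<^sup>2) * (sum c S - M)\<^sup>2"
    proof (cases "S \<in> good")
      case False
      then have "D \<le> \<bar>sum c S - M\<bar>" using S by (auto simp: good_def)
      then have "D\<^sup>2 \<le> (sum c S - M)\<^sup>2" using D by (metis abs_le_square_iff abs_of_pos)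
      then show ?thesis using False D by simp
    qed simp
  qed
  also have "\<dots> = ?E (\<lambda>S. if S \<in> good then 1 else 0) + (1 / D\<^sup>2) * ?E (\<lambda>S. (sum c S - M)\<^sup>2)"
    by (simp only: expect_add expect_cmult)
  also have "(1 / D\<^sup>2) * ?E (\<lambda>S. (sum c S - M)\<^sup>2) \<le> (1 / D\<^sup>2) * (16 * x ^ 12)"
    using var by (intro mult_left_mono) auto
  also have "(1 / D\<^sup>2) * (16 * x ^ 12) = 1 / 4"
    using x by (simp add: D_def power_mult_distrib flip: power_mult)
  also have "?E (\<lambda>S. if S \<in> good then 1 else 0) = sum (config_weight x n) good"
  proof -
    have "?E (\<lambda>S. if S \<in> good then 1 else 0) = (\<Sum>S\<in>{S \<in> Pow {1..n}. S \<in> good}. config_weight x n S)"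
      unfolding expect_config_weight by (subst sum.inter_filter) (auto intro!: sum.cong)
    also have "{S \<in> Pow {1..n}. S \<in> good} = good" by (auto simp: good_def)
    finally show ?thesis .
  qed
  finally have "3 / 4 \<le> sum (config_weight x n) good" by simp
  also have "\<dots> \<le> (\<Sum>S\<in>good. Z * exp (2 * D / x ^ 4) * exp (- (real n / x ^ 4)))"
  proof (intro sum_mono)
    fix S assume S: "S \<in> good"
    then have "0 \<notin> S" "S \<subseteq> {1..n}" by (auto simp: good_def)
    then have "real n - 2 * D \<le> real (odd_size S)"
      using S mean by (simp add: good_def real_odd_size c_def D_def M_def)
    then have "exp (- (real (odd_size S) / x ^ 4)) \<le> exp (- ((real n - 2 * D) / x ^ 4))"
      using x by (simp add: divide_right_mono)
    also have "\<dots> = exp (2 * D / x ^ 4) * exp (- (real n / x ^ 4))"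
      by (simp add: diff_divide_distrib flip: exp_add)
    finally show "config_weight x n S \<le> Z * exp (2 * D / x ^ 4) * exp (- (real n / x ^ 4))"
      using Z config_weight_eq[OF \<open>S \<subseteq> {1..n}\<close>] by (simp add: Z_def mult.assoc)
  qed
  also have "\<dots> = real (card good) * (Z * exp (2 * D / x ^ 4) * exp (- (real n / x ^ 4)))" by simp
  also have "\<dots> \<le> real ((n + 1) * (2 * card (odd_sets n))) * (Z * exp (2 * D / x ^ 4) * exp (- (real n / x ^ 4)))"
  proof (intro mult_right_mono)
    have "good \<subseteq> (\<Union>m\<in>{..n}. odd_sets m)"
    proof
      fix S assume S: "S \<in> good"
      then have z: "0 \<notin> S" "finite S" by (auto simp: good_def intro: finite_subset)
      then have "real (odd_size S) \<le> real n"
        using S mean by (simp add: good_def real_odd_size c_def D_def M_def abs_le_iff)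
      then show "S \<in> (\<Union>m\<in>{..n}. odd_sets m)" using z by (auto simp: odd_sets_def)
    qed
    then have "card good \<le> card (\<Union>m\<in>{..n}. odd_sets m)"
      by (intro card_mono) (auto simp: finite_odd_sets)
    also have "\<dots> \<le> (\<Sum>m\<in>{..n}. card (odd_sets m))" by (rule card_UN_le) simp
    also have "\<dots> \<le> (\<Sum>m\<in>{..n}. 2 * card (odd_sets n))"
      using n by (intro sum_mono card_odd_sets_quasi_mono) auto
    finally show "real (card good) \<le> real ((n + 1) * (2 * card (odd_sets n)))"
      by (simp only: of_nat_le_iff) simp
  qed (use Z in auto)
  also have "\<dots> = 2 * real (n + 1) * exp (2 * D / x ^ 4) * ?P" by (simp add: Z_def distrib_right)
  also have "2 * D / x ^ 4 = 16 * x\<^sup>2" using x by (simp add: D_def field_simps flip: power_add)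
  finally have main: "3 / 4 \<le> 2 * real (n + 1) * exp (16 * x\<^sup>2) * ?P" .
  have "real n \<le> 12 * x ^ 8" by (rule saddle_upper[OF assms])
  moreover have "1 \<le> x ^ 8" using x by simp
  ultimately have "real (n + 1) \<le> 13 * x ^ 8" by simp
  moreover have "x ^ 8 \<le> exp (4 * x\<^sup>2)"
  proof -
    have "x\<^sup>2 \<le> exp (x\<^sup>2)" using exp_ge_add_one_self[of "x\<^sup>2"] by linarith
    then have "(x\<^sup>2) ^ 4 \<le> exp (x\<^sup>2) ^ 4" by (intro power_mono) auto
    then show ?thesis by (simp flip: power_mult exp_of_nat_mult)
  qed
  ultimately have n_le: "2 * real (n + 1) \<le> 26 * exp (4 * x\<^sup>2)" by simp
  \<comment> \<open>One factor \<open>exp (4 * x\<^sup>2)\<close> dominates \<open>x ^ 8\<close>,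
    the other one the numerical constant, because \<open>x \<ge> 1\<close>.\<close>
  have exp8: "exp (4 * x\<^sup>2) * exp (4 * x\<^sup>2) = exp (8 * x\<^sup>2)" by (simp flip: exp_add)
  note n_le
  also have "26 \<le> 3 / 4 * exp (4::real)"
  proof -
    have "5 / 2 \<le> exp (1::real)" using exp_lower_Taylor_quadratic[of 1] by simp
    then have "(5 / 2) ^ 4 \<le> exp (1::real) ^ 4" by (intro power_mono) auto
    then show ?thesis by (simp flip: exp_of_nat_mult) (simp add: power4_eq_xxxx)
  qed
  also have "exp 4 \<le> exp (4 * x\<^sup>2)" using x by (simp add: one_le_power)
  finally have "2 * real (n + 1) \<le> 3 / 4 * exp (8 * x\<^sup>2)" by (simp add: mult.assoc exp8)
  then have "2 * real (n + 1) * exp (16 * x\<^sup>2) * ?P \<le> 3 / 4 * exp (8 * x\<^sup>2) * exp (16 * x\<^sup>2) * ?P"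
    using Z by (intro mult_right_mono) (auto simp: Z_def less_imp_le)
  also have "\<dots> = 3 / 4 * (exp (24 * x\<^sup>2) * ?P)" by (simp flip: exp_add add: mult.assoc)
  finally have "1 \<le> exp (24 * x\<^sup>2) * ?P" using main by linarith
  then show ?thesis by (simp add: exp_minus field_simps)
qed

section \<open>Means over the sets of a given size\<close>

definition mean_over :: "nat \<Rightarrow> (nat set \<Rightarrow> real) \<Rightarrow> real" where
  "mean_over n X = (\<Sum>S\<in>odd_sets n. X S) / real (card (odd_sets n))"

lemma card_odd_sets_pos: "saddle n x \<Longrightarrow> 0 < card (odd_sets n)"
  using prob_size_ge[of n x] by (cases "card (odd_sets n) = 0") (auto simp: not_le)

text \<open>All sets in \<open>odd_sets n\<close> have the same weight, so by Jensen's inequality an exponential moment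
  of the unconditioned model controls the uniform mean.\<close>

lemma mean_over_exp_moment:
  assumes "saddle n x" and R: "expect {1..n} (part_prob x) (\<lambda>S. exp (\<theta> * X S)) \<le> exp R"
  shows "\<theta> * mean_over n X \<le> R + 24 * x\<^sup>2"
proof -
  define a where "a = \<theta> * mean_over n X"
  define W where "W = (\<Prod>k=1..n. 1 - part_prob x k) * exp (- (real n / x ^ 4))"
  have W: "0 < W" unfolding W_def using part_prob_bounds by (intro mult_pos_pos prod_pos) auto
  define q where "q = real (card (odd_sets n))"
  have q: "0 < q" using card_odd_sets_pos[OF assms(1)] by (simp add: q_def)
  \<comment> \<open>Tangent line of \<open>exp\<close> at \<open>a\<close>: the linear terms sum to
    0 because \<open>a\<close> is the mean of \<open>\<theta> * X S\<close>.\<close>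
  have "q * exp a = exp a * (q + (\<theta> * (\<Sum>S\<in>odd_sets n. X S) - q * a))"
    using q by (simp add: a_def mean_over_def q_def)
  also have "\<dots> = (\<Sum>S\<in>odd_sets n. exp a * (1 + (\<theta> * X S - a)))"
    by (simp add: sum.distrib sum_subtractf q_def flip: sum_distrib_left)
  also have "\<dots> \<le> (\<Sum>S\<in>odd_sets n. exp (\<theta> * X S))"
  proof (intro sum_mono)
    fix S
    have "exp a * (1 + (\<theta> * X S - a)) \<le> exp a * exp (\<theta> * X S - a)"
      by (intro mult_left_mono) auto
    then show "exp a * (1 + (\<theta> * X S - a)) \<le> exp (\<theta> * X S)" by (simp flip: exp_add)
  qed
  finally have jensen: "q * exp a \<le> (\<Sum>S\<in>odd_sets n. exp (\<theta> * X S))" .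
  have "exp (- 24 * x\<^sup>2) * exp a \<le> q * W * exp a"
    using prob_size_ge[OF assms(1)] by (intro mult_right_mono) (auto simp: q_def W_def)
  also have "\<dots> \<le> W * (\<Sum>S\<in>odd_sets n. exp (\<theta> * X S))"
    using mult_left_mono[OF jensen, of W] W by (simp add: mult_ac)
  also have "\<dots> = (\<Sum>S\<in>odd_sets n. config_weight x n S * exp (\<theta> * X S))"
    unfolding sum_distrib_left
  proof (intro sum.cong refl)
    fix S assume S: "S \<in> odd_sets n"
    then have "odd_size S = n" by (simp add: odd_sets_def)
    then show "W * exp (\<theta> * X S) = config_weight x n S * exp (\<theta> * X S)"
      using config_weight_eq[OF odd_sets_subset[OF S], of n x] by (simp add: W_def)
  qed
  also have "\<dots> \<le> (\<Sum>S\<in>Pow {1..n}. config_weight x n S * exp (\<theta> * X S))"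
    using odd_sets_subset[of _ n n] config_weight_nonneg by (intro sum_mono2) auto
  also have "\<dots> \<le> exp R" using R unfolding expect_config_weight .
  finally have "exp (a - 24 * x\<^sup>2) \<le> exp R" by (simp flip: exp_add)
  then show ?thesis by (simp add: a_def)
qed

section \<open>Exponential moments of pattern counts\<close>

definition pattern_prob :: "nat \<Rightarrow> nat set \<Rightarrow> (nat \<Rightarrow> real) \<Rightarrow> nat \<Rightarrow> real" where
  "pattern_prob t J p k = p k * (\<Prod>j\<in>J. p (k - j)) * (\<Prod>j\<in>{1..t} - J. 1 - p (k - j))"

lemma expect_indicator:
  assumes "finite A" "T \<subseteq> A"
  shows "expect A p (\<lambda>S. if S = T then 1 else 0) = prod p T * (\<Prod>k\<in>A - T. 1 - p k)"
  using assms unfolding expect_def by (simp add: sum.delta if_distrib cong: if_cong)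

text \<open>Among the subsets of \<open>{k - t..k}\<close> the event prescribes every element, so it
  singles out one set \<open>T0\<close> and its probability is a single product. The value
  \<open>c\<close> will be \<open>exp \<theta>\<close>.\<close>

lemma expect_pattern:
  assumes "t < k" "J \<subseteq> {1..t}"
  shows "expect {k - t..k} p (\<lambda>T. if k \<in> T \<and> window t T k = J then c else 1) = 1 + pattern_prob t J p k * (c - 1)"
proof -
  define T0 where "T0 = insert k ((\<lambda>j. k - j) ` J)"
  have inj: "inj_on (\<lambda>j. k - j) {1..t}" using assms by (auto simp: inj_on_def)
  have fin: "finite J" using assms finite_subset by blast
  have T0: "T0 \<subseteq> {k - t..k}" by (auto simp: T0_def dest!: subsetD[OF assms(2)])
  have iff: "k \<in> T \<and> window t T k = J \<longleftrightarrow> T = T0" if T: "T \<subseteq> {k - t..k}" for T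
  proof
    assume *: "k \<in> T \<and> window t T k = J"
    show "T = T0"
    proof (intro equalityI subsetI)
      fix a assume a: "a \<in> T"
      show "a \<in> T0"
      proof (cases "a = k")
        case False
        then have "k - a \<in> J" using a T * assms(1) by (fastforce simp: window_def)
        moreover have "a = k - (k - a)" using a T by fastforce
        ultimately show ?thesis by (auto simp: T0_def)
      qed (simp add: T0_def)
    qed (use * in \<open>auto simp: T0_def window_def\<close>)
  next
    assume *: "T = T0"
    have "k - i \<in> T0 \<longleftrightarrow> i \<in> J" if "i \<in> {1..t}" for i
    proof
      assume "k - i \<in> T0"
      moreover have "k - i \<noteq> k" using that assms(1) by auto
      ultimately obtain j where "j \<in> J" "k - i = k - j" by (auto simp: T0_def)
      then show "i \<in> J" using inj_onD[OF inj, of i j] that assms(2) by auto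
    qed (auto simp: T0_def)
    then show "k \<in> T \<and> window t T k = J" using assms(2) unfolding * by (auto simp: window_def T0_def)
  qed
  have "k \<notin> (\<lambda>j. k - j) ` J" using assms(1) by (auto dest!: subsetD[OF assms(2)])
  then have 1: "prod p T0 = p k * (\<Prod>j\<in>J. p (k - j))"
    unfolding T0_def using fin inj assms(2)
    by (subst prod.insert) (auto simp: prod.reindex inj_on_subset)
  have "{k - t..k} - T0 = (\<lambda>j. k - j) ` ({1..t} - J)"
  proof (intro equalityI subsetI)
    fix a assume a: "a \<in> {k - t..k} - T0"
    then have "k - a \<in> {1..t} - J" "a = k - (k - a)" using assms(1)
      by (auto simp: T0_def image_iff)
    then show "a \<in> (\<lambda>j. k - j) ` ({1..t} - J)" by blast
  next
    fix a assume "a \<in> (\<lambda>j. k - j) ` ({1..t} - J)"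
    then obtain j where j: "j \<in> {1..t}" "j \<notin> J" "a = k - j" by auto
    have "a \<notin> T0"
    proof
      assume "a \<in> T0"
      then obtain i where "i \<in> J" "k - j = k - i" using j assms(1) by (auto simp: T0_def)
      then show False using inj_onD[OF inj, of j i] j assms(2) by auto
    qed
    then show "a \<in> {k - t..k} - T0" using j by auto
  qed
  then have 2: "(\<Prod>a\<in>{k - t..k} - T0. 1 - p a) = (\<Prod>j\<in>{1..t} - J. 1 - p (k - j))"
    using inj by (simp add: prod.reindex inj_on_subset)
  have "expect {k - t..k} p (\<lambda>T. if k \<in> T \<and> window t T k = J then c else 1) =
      expect {k - t..k} p (\<lambda>T. 1 + (c - 1) * (if T = T0 then 1 else 0))"
    using iff by (intro expect_cong) auto
  also have "\<dots> = 1 + (c - 1) * (prod p T0 * (\<Prod>a\<in>{k - t..k} - T0. 1 - p a))"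
    using T0 by (simp only: expect_add expect_cmult expect_const expect_indicator finite_atLeastAtMost)
  finally show ?thesis by (simp add: 1 2 pattern_prob_def mult_ac)
qed

lemma exp_le_quadratic: "\<bar>\<theta>\<bar> \<le> 1 \<Longrightarrow> exp \<theta> \<le> 1 + \<theta> + (\<theta>::real)\<^sup>2"
proof (cases "0 \<le> \<theta>")
  case False
  assume *: "\<bar>\<theta>\<bar> \<le> 1"
  define u where "u = - \<theta>"
  have u: "0 \<le> u" "u \<le> 1" using * False by (auto simp: u_def)
  \<comment> \<open>For \<open>\<theta> = - u\<close> the claim amounts to
    \<open>1 \<le> (1 - u + u\<^sup>2) * exp u\<close>, where \<open>exp u\<close> may be replaced
    by its quadratic Taylor polynomial from below.\<close>
  have "1 \<le> (1 - u + u\<^sup>2) * (1 + u + u\<^sup>2 / 2)"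
  proof -
    have "(1 - u + u\<^sup>2) * (1 + u + u\<^sup>2 / 2) = 1 + u\<^sup>2 / 2 + u ^ 3 / 2 + u ^ 4 / 2"
      by (simp add: power2_eq_square power3_eq_cube power4_eq_xxxx field_simps)
    then show ?thesis using u by simp
  qed
  also have "\<dots> \<le> (1 - u + u\<^sup>2) * exp u"
    using exp_lower_Taylor_quadratic[OF u(1)] u by (intro mult_left_mono) auto
  finally show ?thesis by (simp add: u_def exp_minus field_simps)
qed (use exp_bound[of \<theta>] in auto)

lemma pattern_prob_nonneg: "0 \<le> pattern_prob t J (part_prob x) k"
  unfolding pattern_prob_def using part_prob_bounds
  by (intro mult_nonneg_nonneg prod_nonneg) (auto simp: less_imp_le)

text \<open>Members of \<open>C\<close> are more than \<open>t\<close> apart, so their blocks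
  \<open>{k - t..k}\<close> are disjoint and the exponential moment factors exactly. Each factor is
  then bounded through \<open>exp \<theta> - 1 \<le> \<theta> + \<theta>\<^sup>2\<close>, which
  covers both signs of \<open>\<theta>\<close>.\<close>

lemma exp_moment_pattern_class:
  assumes C: "C \<subseteq> {t<..n}" "\<And>k k'. k \<in> C \<Longrightarrow> k' \<in> C \<Longrightarrow> k < k' \<Longrightarrow> k + t < k'"
    and J: "J \<subseteq> {1..t}" and "\<bar>\<theta>\<bar> \<le> 1"
  shows "expect {1..n} (part_prob x) (\<lambda>S. exp (\<theta> * real (card {k \<in> C. k \<in> S \<and> window t S k = J})))
    \<le> exp ((\<theta> + \<theta>\<^sup>2) * (\<Sum>k\<in>C. pattern_prob t J (part_prob x) k))"
proof -
  let ?p = "part_prob x"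
  have fin: "finite C" using C(1) finite_subset by blast
  define G where "G k T = (if k \<in> T \<and> window t T k = J then exp \<theta> else 1)" for k T
  have "exp (\<theta> * real (card {k \<in> C. k \<in> S \<and> window t S k = J})) = (\<Prod>k\<in>C. G k (S \<inter> {k - t..k}))" for S
  proof -
    have "window t (S \<inter> {k - t..k}) k = window t S k" for k by (auto simp: window_def)
    then have "(\<Prod>k\<in>C. G k (S \<inter> {k - t..k})) = (\<Prod>k\<in>C. if k \<in> S \<and> window t S k = J then exp \<theta> else 1)"
      by (simp add: G_def)
    also have "\<dots> = (\<Prod>k\<in>{k \<in> C. k \<in> S \<and> window t S k = J}. exp \<theta>)"
      by (rule prod.inter_filter[OF fin, symmetric])
    finally show ?thesis by (simp add: mult.commute flip: exp_of_nat_mult)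
  qed
  then have "expect {1..n} ?p (\<lambda>S. exp (\<theta> * real (card {k \<in> C. k \<in> S \<and> window t S k = J}))) =
      expect {1..n} ?p (\<lambda>S. \<Prod>k\<in>C. G k (S \<inter> {k - t..k}))" by simp
  also have "\<dots> = (\<Prod>k\<in>C. expect {k - t..k} ?p (G k))"
  proof (rule expect_blocks)
    show "{k - t..k} \<subseteq> {1..n}" if "k \<in> C" for k using that C(1) by (auto simp: subset_iff)
    show "{i - t..i} \<inter> {j - t..j} = {}" if "i \<in> C" "j \<in> C" "i \<noteq> j" for i j
      using that C(2)[of i j] C(2)[of j i] by (cases "i < j") auto
  qed (use fin in auto)
  also have "\<dots> = (\<Prod>k\<in>C. 1 + pattern_prob t J ?p k * (exp \<theta> - 1))"
    unfolding G_def using C(1) J by (intro prod.cong expect_pattern) auto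
  also have "\<dots> \<le> (\<Prod>k\<in>C. exp ((\<theta> + \<theta>\<^sup>2) * pattern_prob t J ?p k))"
  proof (rule prod_mono)
    fix k assume k: "k \<in> C"
    have pi: "0 \<le> pattern_prob t J ?p k" by (rule pattern_prob_nonneg)
    have "pattern_prob t J ?p k * (exp \<theta> - 1) \<le> pattern_prob t J ?p k * (\<theta> + \<theta>\<^sup>2)"
      using exp_le_quadratic[OF assms(4)] pi by (intro mult_left_mono) auto
    also have "1 + \<dots> \<le> exp ((\<theta> + \<theta>\<^sup>2) * pattern_prob t J ?p k)"
      using exp_ge_add_one_self[of "pattern_prob t J ?p k * (\<theta> + \<theta>\<^sup>2)"] by (simp add: mult.commute)
    finally have "1 + pattern_prob t J ?p k * (exp \<theta> - 1) \<le> exp ((\<theta> + \<theta>\<^sup>2) * pattern_prob t J ?p k)" by simp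
    moreover have "0 \<le> 1 + pattern_prob t J ?p k * (exp \<theta> - 1)"
    proof -
      have "pattern_prob t J ?p k \<le> 1"
        unfolding pattern_prob_def using part_prob_bounds[of x]
        by (intro mult_le_one mult_nonneg_nonneg prod_nonneg prod_le_1) (auto simp: less_imp_le)
      moreover have "pattern_prob t J ?p k * (1 - exp \<theta>) \<le> pattern_prob t J ?p k * 1"
        using pi by (intro mult_left_mono) auto
      ultimately show ?thesis by (simp add: algebra_simps)
    qed
    ultimately show "0 \<le> 1 + pattern_prob t J ?p k * (exp \<theta> - 1) \<and>
        1 + pattern_prob t J ?p k * (exp \<theta> - 1) \<le> exp ((\<theta> + \<theta>\<^sup>2) * pattern_prob t J ?p k)" by simp
  qed
  also have "\<dots> = exp ((\<theta> + \<theta>\<^sup>2) * (\<Sum>k\<in>C. pattern_prob t J ?p k))"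
    using fin by (simp add: exp_sum sum_distrib_left)
  finally show ?thesis .
qed

definition pattern_count :: "nat \<Rightarrow> nat set \<Rightarrow> nat set \<Rightarrow> nat" where
  "pattern_count t J S = card {k \<in> S. t < k \<and> window t S k = J}"

lemma mean_over_sum: "mean_over n (\<lambda>S. \<Sum>i\<in>I. X i S) = (\<Sum>i\<in>I. mean_over n (X i))"
  unfolding mean_over_def by (subst sum.swap) (simp add: sum_divide_distrib)

text \<open>Within a residue class modulo \<open>t + 1\<close> the moment bound applies, with
  \<open>\<theta> = 1 / x\<close> for the upper and \<open>\<theta> = - (1 / x)\<close> for the
  lower estimate. Dividing by \<open>\<bar>\<theta>\<bar>\<close> leaves a quadratic term
  \<open>m r / x\<close> and a cost \<open>24 * x ^ 3\<close> per class; as \<open>\<mu>\<close> has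
  order \<open>x ^ 4\<close>, this choice balances the two.\<close>

lemma mean_pattern_count:
  assumes "saddle n x" "J \<subseteq> {1..t}"
  defines "\<mu> \<equiv> (\<Sum>k\<in>{t<..n}. pattern_prob t J (part_prob x) k)"
  shows "\<bar>mean_over n (\<lambda>S. real (pattern_count t J S)) - \<mu>\<bar> \<le> \<mu> / x + 24 * real (t + 1) * x ^ 3"
proof -
  have x: "1 \<le> x" using assms(1) by (simp add: saddle_def)
  define C where "C r = {k \<in> {t<..n}. k mod (t + 1) = r}" for r
  define X where "X r S = real (card {k \<in> C r. k \<in> S \<and> window t S k = J})" for r S
  define m where "m r = (\<Sum>k\<in>C r. pattern_prob t J (part_prob x) k)" for r
  have gap: "k + t < k'" if "k \<in> C r" "k' \<in> C r" "k < k'" for r k k'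
  proof -
    have "(t + 1) dvd (k' - k)" using that by (auto simp: C_def mod_eq_dvd_iff_nat)
    then have "t + 1 \<le> k' - k" using that(3) by (intro dvd_imp_le) auto
    then show ?thesis by linarith
  qed
  have bound: "\<theta> * mean_over n (X r) \<le> (\<theta> + \<theta>\<^sup>2) * m r + 24 * x\<^sup>2" if "\<bar>\<theta>\<bar> \<le> 1" for r \<theta>
    unfolding X_def m_def
    by (intro mean_over_exp_moment exp_moment_pattern_class assms that gap) (auto simp: C_def)
  have "\<bar>mean_over n (X r) - m r\<bar> \<le> m r / x + 24 * x ^ 3" for r
  proof -
    have "mean_over n (X r) = x * (1 / x * mean_over n (X r))" using x by simp
    also have "\<dots> \<le> x * ((1 / x + (1 / x)\<^sup>2) * m r + 24 * x\<^sup>2)"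
      using x by (intro mult_left_mono bound) auto
    also have "\<dots> = m r + m r / x + 24 * x ^ 3"
      using x by (simp add: power2_eq_square power3_eq_cube field_simps)
    finally have up: "mean_over n (X r) \<le> m r + m r / x + 24 * x ^ 3" .
    have "- mean_over n (X r) = x * (- (1 / x) * mean_over n (X r))" using x by simp
    also have "\<dots> \<le> x * ((- (1 / x) + (- (1 / x))\<^sup>2) * m r + 24 * x\<^sup>2)"
      using x by (intro mult_left_mono bound) auto
    also have "\<dots> = - m r + m r / x + 24 * x ^ 3"
      using x by (simp add: power2_eq_square power3_eq_cube field_simps)
    finally have down: "- mean_over n (X r) \<le> - m r + m r / x + 24 * x ^ 3" .
    with up show ?thesis by linarith
  qed
  then have "\<bar>\<Sum>r\<le>t. mean_over n (X r) - m r\<bar> \<le> (\<Sum>r\<le>t. m r / x + 24 * x ^ 3)"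
    by (intro order_trans[OF sum_abs] sum_mono)
  moreover have "(\<Sum>r\<le>t. m r) = \<mu>"
  proof -
    have "(\<Sum>r\<le>t. m r) = sum (pattern_prob t J (part_prob x)) (\<Union>r\<in>{..t}. C r)"
      unfolding m_def by (rule sum.UNION_disjoint[symmetric]) (auto simp: C_def)
    also have "(\<Union>r\<in>{..t}. C r) = {t<..n}"
      using mod_less_divisor[of "t + 1"] by (force simp: C_def less_Suc_eq_le)
    finally show ?thesis by (simp add: \<mu>_def)
  qed
  moreover have "(\<Sum>r\<le>t. mean_over n (X r)) = mean_over n (\<lambda>S. real (pattern_count t J S))"
  proof -
    have "(\<Sum>r\<le>t. X r S) = real (pattern_count t J S)" if S: "S \<in> odd_sets n" for S
    proof -
      have "{k \<in> S. t < k \<and> window t S k = J} = (\<Union>r\<in>{..t}. {k \<in> C r. k \<in> S \<and> window t S k = J})"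
        using odd_sets_subset[OF S order_refl] mod_less_divisor[of "t + 1"]
        by (force simp: C_def less_Suc_eq_le)
      then have "pattern_count t J S = (\<Sum>r\<le>t. card {k \<in> C r. k \<in> S \<and> window t S k = J})"
        unfolding pattern_count_def by (simp only:) (rule card_UN_disjoint; auto simp: C_def)
      then show ?thesis by (simp add: X_def)
    qed
    then have "mean_over n (\<lambda>S. \<Sum>r\<le>t. X r S) = mean_over n (\<lambda>S. real (pattern_count t J S))"
      by (simp add: mean_over_def)
    then show ?thesis by (simp add: mean_over_sum)
  qed
  ultimately show ?thesis
    by (simp add: sum_subtractf sum.distrib sum_divide_distrib[symmetric] algebra_simps)
qed

section \<open>Riemann sums\<close>

lemma ex_saddle:
  assumes "12 \<le> n"
  shows "\<exists>x. saddle n x"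
proof -
  let ?f = "\<lambda>x. mean_size x n + 8 * x ^ 6"
  have "0 \<le> mean_size (real n) n" by (rule mean_size_nonneg)
  moreover have "real n \<le> real n ^ 6" using assms by (intro self_le_power) auto
  ultimately have "real n \<le> ?f (real n)" by linarith
  \<comment> \<open>At \<open>x = 1\<close> the mean is at most 4 and the offset is 8, whence the
    threshold 12.\<close>
  moreover have "?f 1 \<le> real n" using mean_size_le[of 1 n] assms by simp
  moreover have "continuous_on {1..real n} ?f"
    unfolding mean_size_def part_prob_def
    by (intro continuous_intros) (auto simp: add_pos_pos less_imp_neq[symmetric])
  ultimately obtain x where "1 \<le> x" "?f x = real n"
    using IVT'[of ?f 1 "real n" "real n"] assms by auto
  then show ?thesis using assms by (auto simp: saddle_def)
qed

definition saddle_at :: "nat \<Rightarrow> real" where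
  "saddle_at n = (SOME x. saddle n x)"

lemma saddle_at: "12 \<le> n \<Longrightarrow> saddle n (saddle_at n)"
  unfolding saddle_at_def using ex_saddle someI_ex by metis

text \<open>Every saddle satisfies \<open>n \<le> 12 * x ^ 8\<close>, so whichever one
  \<open>SOME\<close> picks must grow with \<open>n\<close>.\<close>

lemma filterlim_saddle_at: "filterlim saddle_at at_top sequentially"
  unfolding filterlim_at_top
proof
  fix Z :: real
  obtain N :: nat where N: "12 * Z ^ 8 < real N" using reals_Archimedean2 by blast
  show "\<forall>\<^sub>F n in sequentially. Z \<le> saddle_at n"
    using eventually_ge_at_top[of "max 12 N"]
  proof eventually_elim
    case (elim n)
    define x where "x = saddle_at n"
    have s: "saddle n x" using saddle_at[of n] elim by (simp add: x_def)
    then have x: "1 \<le> x" by (simp add: saddle_def)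
    have n: "real n \<le> 12 * x ^ 8" by (rule saddle_upper[OF s])
    have "12 * x ^ 8 \<le> 12 * Z ^ 8" if "x \<le> Z" using that x by (simp add: power_mono)
    then show ?case using n N elim by (fastforce simp: x_def)
  qed
qed

text \<open>In the variable \<open>u = (2 * k - 1) / x ^ 4\<close> the sums stop near
  \<open>2 * n / x ^ 4\<close>; since this tends to infinity, the cut at \<open>n\<close> is
  harmless. The offset \<open>8 * x ^ 6\<close> in \<open>saddle\<close> alone gives
  \<open>n \<ge> x ^ 5\<close>.\<close>

lemma filterlim_saddle_at_ratio: "filterlim (\<lambda>n. real n / saddle_at n ^ 4) at_top sequentially"
proof (rule filterlim_at_top_mono[OF filterlim_saddle_at])
  show "\<forall>\<^sub>F n in sequentially. saddle_at n \<le> real n / saddle_at n ^ 4"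
    using eventually_ge_at_top[of 12]
  proof eventually_elim
    case (elim n)
    define x where "x = saddle_at n"
    have x: "1 \<le> x" "real n = mean_size x n + 8 * x ^ 6"
      using saddle_at[OF elim] by (auto simp: saddle_def x_def)
    have "x ^ 5 \<le> real n" using x mean_size_nonneg[of x n] power_increasing[of 5 6 x] by simp
    then have "x * x ^ 4 \<le> real n" by (simp flip: power_Suc)
    then show ?case using x by (simp add: field_simps flip: x_def)
  qed
qed

section \<open>Powers of the Fermi function and their integrals\<close>

definition fermi :: "real \<Rightarrow> real" where
  "fermi u = 1 / (1 + exp u)"

text \<open>An antiderivative of \<open>fermi ^ Suc m\<close> vanishing at infinity.\<close>

definition fermi_primitive :: "nat \<Rightarrow> real \<Rightarrow> real" where
  "fermi_primitive m u = - ln (1 + exp (- u)) + (\<Sum>j<m. fermi u ^ Suc j / real (Suc j))"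

lemma fermi_pos: "0 < fermi u"
  by (simp add: fermi_def add_pos_pos)

lemma part_prob_fermi: "part_prob x k = fermi ((2 * real k - 1) / x ^ 4)"
  by (simp add: part_prob_def fermi_def)

lemma fermi_antimono: "u \<le> v \<Longrightarrow> fermi v \<le> fermi u"
  unfolding fermi_def by (intro divide_left_mono) (auto simp: add_pos_pos)

lemma exp_add_one_nonzero: "1 + exp (u::real) \<noteq> 0"
  using add_pos_pos[OF zero_less_one exp_gt_zero[of u]] by linarith

text \<open>The derivative of \<open>fermi\<close> is \<open>- (fermi u * (1 - fermi u))\<close>, so
  \<open>fermi u ^ Suc m / Suc m\<close> has derivative
  \<open>fermi u ^ Suc (Suc m) - fermi u ^ Suc m\<close>: adding it raises the power by one.\<close>

lemma has_derivative_fermi_primitive: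
  "(fermi_primitive m has_real_derivative fermi u ^ Suc m) (at u)"
proof (induction m)
  case 0
  have "((\<lambda>u. - ln (1 + exp (- u))) has_real_derivative - (1 / (1 + exp (- u)) * (exp (- u) * - 1))) (at u)"
    by (auto intro!: derivative_eq_intros simp: add_pos_pos)
  moreover have "- (1 / (1 + exp (- u)) * (exp (- u) * - 1)) = fermi u"
    by (simp add: fermi_def exp_minus field_simps)
  ultimately show ?case by (simp add: fermi_primitive_def[abs_def])
next
  case (Suc m)
  have "(fermi has_real_derivative - (fermi u * (1 - fermi u))) (at u)"
    unfolding fermi_def[abs_def] using exp_add_one_nonzero[of u]
    by (auto intro!: derivative_eq_intros simp: field_simps power2_eq_square)
  then have "((\<lambda>u. fermi u ^ Suc m / real (Suc m)) has_real_derivative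
      real (Suc m) * (- (fermi u * (1 - fermi u)) * fermi u ^ m) / real (Suc m)) (at u)"
    using DERIV_power_Suc[of fermi "- (fermi u * (1 - fermi u))" u UNIV m]
    by (intro DERIV_cdivide) (simp only: of_nat_Suc add.commute[of 1])
  also have "real (Suc m) * (- (fermi u * (1 - fermi u)) * fermi u ^ m) / real (Suc m) =
      fermi u ^ Suc (Suc m) - fermi u ^ Suc m"
    by (subst nonzero_mult_div_cancel_left) (simp_all add: algebra_simps del: of_nat_Suc)
  finally have "((\<lambda>u. fermi_primitive m u + fermi u ^ Suc m / real (Suc m)) has_real_derivative
      fermi u ^ Suc m + (fermi u ^ Suc (Suc m) - fermi u ^ Suc m)) (at u)"
    by (intro DERIV_add Suc.IH)
  moreover have "fermi_primitive (Suc m) = (\<lambda>u. fermi_primitive m u + fermi u ^ Suc m / real (Suc m))"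
    by (rule ext) (simp add: fermi_primitive_def)
  ultimately show ?case by (simp only: add_diff_cancel_left' diff_add_cancel add.commute[of "fermi u ^ Suc m"])
qed

lemma fermi_primitive_diff_bounds:
  assumes "a < b"
  shows "(b - a) * fermi b ^ Suc m \<le> fermi_primitive m b - fermi_primitive m a"
    and "fermi_primitive m b - fermi_primitive m a \<le> (b - a) * fermi a ^ Suc m"
proof -
  obtain z where z: "a < z" "z < b" "fermi_primitive m b - fermi_primitive m a = (b - a) * fermi z ^ Suc m"
    using MVT2[OF assms, of "fermi_primitive m" "\<lambda>u. fermi u ^ Suc m"]
      has_derivative_fermi_primitive by blast
  have "fermi b ^ Suc m \<le> fermi z ^ Suc m" "fermi z ^ Suc m \<le> fermi a ^ Suc m"
    using z fermi_pos fermi_antimono by (intro power_mono; simp add: less_imp_le)+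
  then show "(b - a) * fermi b ^ Suc m \<le> fermi_primitive m b - fermi_primitive m a"
    "fermi_primitive m b - fermi_primitive m a \<le> (b - a) * fermi a ^ Suc m"
    unfolding z(3) using assms by (auto intro!: mult_left_mono)
qed

lemma tendsto_fermi_primitive_at_top: "(fermi_primitive m \<longlongrightarrow> 0) at_top"
proof -
  have 0: "((\<lambda>u::real. exp (- u)) \<longlongrightarrow> 0) at_top"
    by (rule filterlim_compose[OF exp_at_bot filterlim_uminus_at_bot_at_top])
  have "((\<lambda>u::real. - ln (1 + exp (- u))) \<longlongrightarrow> - ln (1 + 0)) at_top"
    by (intro tendsto_intros 0) auto
  then have 1: "((\<lambda>u::real. - ln (1 + exp (- u))) \<longlongrightarrow> 0) at_top" by simp
  have "((\<lambda>u::real. exp (- u) / (1 + exp (- u))) \<longlongrightarrow> 0 / (1 + 0)) at_top"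
    by (intro tendsto_intros 0) auto
  moreover have "fermi u = exp (- u) / (1 + exp (- u))" for u
    using exp_add_one_nonzero[of u] by (simp add: fermi_def exp_minus field_simps)
  then have "fermi = (\<lambda>u. exp (- u) / (1 + exp (- u)))" by (rule ext)
  ultimately have 2: "(fermi \<longlongrightarrow> 0) at_top" by simp
  have "((\<lambda>u. - ln (1 + exp (- u)) + (\<Sum>j<m. fermi u ^ Suc j / real (Suc j))) \<longlongrightarrow>
      0 + (\<Sum>j<m. 0 ^ Suc j / real (Suc j))) at_top"
    by (intro tendsto_intros 1 2) auto
  then show ?thesis by (simp add: fermi_primitive_def[abs_def])
qed

definition scaled_sum :: "(real \<Rightarrow> real) \<Rightarrow> nat \<Rightarrow> real" where
  "scaled_sum \<phi> n = (\<Sum>k=1..n. \<phi> (part_prob (saddle_at n) k)) / saddle_at n ^ 4"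

text \<open>The sample points \<open>(2 * k - 1) * s n\<close> have spacing \<open>2 * s n\<close>,
  so the limit is half the integral of \<open>fermi u ^ Suc m\<close> over the positive axis, and
  that integral is \<open>- fermi_primitive m 0\<close>. Monotonicity compares each term with an
  adjacent cell, and the differences of \<open>G\<close> telescope.\<close>

lemma scaled_sum_power_tendsto:
  "scaled_sum (\<lambda>p. p ^ Suc m) \<longlonglongrightarrow> - fermi_primitive m 0 / 2"
proof -
  define s where "s n = 1 / saddle_at n ^ 4" for n
  define G where "G = fermi_primitive m"
  have s0: "s \<longlonglongrightarrow> 0"
    unfolding s_def
    by (intro tendsto_divide_0[OF tendsto_const] filterlim_at_top_imp_at_infinity
        filterlim_pow_at_top filterlim_saddle_at) auto
  have ns: "filterlim (\<lambda>n. real n * s n) at_top sequentially"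
    using filterlim_saddle_at_ratio by (simp add: s_def)
  have Gtop: "(G \<longlongrightarrow> 0) at_top" unfolding G_def by (rule tendsto_fermi_primitive_at_top)
  have Gcont: "isCont G 0" unfolding G_def using has_derivative_fermi_primitive DERIV_isCont by blast
  have pos: "\<forall>\<^sub>F n in sequentially. 0 < s n"
    using filterlim_at_top_dense[THEN iffD1, OF filterlim_saddle_at, rule_format, of 0]
    by eventually_elim (simp add: s_def)
  have F: "scaled_sum (\<lambda>p. p ^ Suc m) n = s n * (\<Sum>k=1..n. fermi ((2 * real k - 1) * s n) ^ Suc m)" for n
    by (simp add: scaled_sum_def part_prob_fermi s_def)
  have lower: "\<forall>\<^sub>F n in sequentially. (G ((2 * real n + 1) * s n) - G (s n)) / 2 \<le> scaled_sum (\<lambda>p. p ^ Suc m) n"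
    using pos
  proof eventually_elim
    case (elim n)
    have "G ((2 * real N + 1) * s n) - G (s n) \<le> 2 * s n * (\<Sum>k=1..N. fermi ((2 * real k - 1) * s n) ^ Suc m)" for N
    proof (induction N)
      case (Suc N)
      have "G ((2 * real (Suc N) + 1) * s n) - G ((2 * real (Suc N) - 1) * s n)
          \<le> 2 * s n * fermi ((2 * real (Suc N) - 1) * s n) ^ Suc m"
        using fermi_primitive_diff_bounds(2)[of "(2 * real (Suc N) - 1) * s n" "(2 * real (Suc N) + 1) * s n" m] elim
        by (simp add: G_def algebra_simps)
      then show ?case using Suc by (simp add: algebra_simps)
    qed simp
    from this[of n] show ?case unfolding F by simp
  qed
  have upper: "\<forall>\<^sub>F n in sequentially. scaled_sum (\<lambda>p. p ^ Suc m) n \<le> (G ((2 * real n - 1) * s n) - G (- s n)) / 2"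
    using pos
  proof eventually_elim
    case (elim n)
    \<comment> \<open>Each term is compared with the cell to the left of its sample point; the first
      cell runs from \<open>- s n\<close> to \<open>s n\<close>, hence the argument
      \<open>- s n\<close>.\<close>
    have "2 * s n * (\<Sum>k=1..N. fermi ((2 * real k - 1) * s n) ^ Suc m) \<le> G ((2 * real N - 1) * s n) - G (- s n)" for N
    proof (induction N)
      case (Suc N)
      have "2 * s n * fermi ((2 * real (Suc N) - 1) * s n) ^ Suc m
          \<le> G ((2 * real (Suc N) - 1) * s n) - G ((2 * real N - 1) * s n)"
        using fermi_primitive_diff_bounds(1)[of "(2 * real N - 1) * s n" "(2 * real (Suc N) - 1) * s n" m] elim
        by (simp add: G_def algebra_simps)
      then show ?case using Suc by (simp add: algebra_simps)
    qed simp
    from this[of n] show ?case unfolding F by simp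
  qed
  have "filterlim (\<lambda>n. (2 * real n + 1) * s n) at_top sequentially"
    by (rule filterlim_at_top_mono[OF ns], use pos in eventually_elim) (simp add: algebra_simps)
  moreover have "filterlim (\<lambda>n. (2 * real n - 1) * s n) at_top sequentially"
    by (rule filterlim_at_top_mono[OF ns], use pos eventually_ge_at_top[of 1] in eventually_elim)
      (simp add: mult_right_mono)
  ultimately have lim: "(\<lambda>n. G ((2 * real n + 1) * s n)) \<longlonglongrightarrow> 0" "(\<lambda>n. G ((2 * real n - 1) * s n)) \<longlonglongrightarrow> 0"
    using filterlim_compose[OF Gtop] by blast+
  have lim': "(\<lambda>n. G (s n)) \<longlonglongrightarrow> G 0" "(\<lambda>n. G (- s n)) \<longlonglongrightarrow> G 0"
    using isCont_tendsto_compose[OF Gcont s0]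
      isCont_tendsto_compose[of 0 G "\<lambda>n. - s n"] Gcont tendsto_minus[OF s0] by simp_all
  have "(\<lambda>n. (G ((2 * real n + 1) * s n) - G (s n)) / 2) \<longlonglongrightarrow> (0 - G 0) / 2"
    "(\<lambda>n. (G ((2 * real n - 1) * s n) - G (- s n)) / 2) \<longlonglongrightarrow> (0 - G 0) / 2"
    by (intro tendsto_intros lim lim'; simp)+
  then have "scaled_sum (\<lambda>p. p ^ Suc m) \<longlonglongrightarrow> (0 - G 0) / 2"
    by (rule tendsto_sandwich[OF lower upper])
  then show ?thesis by (simp add: G_def)
qed

lemma scaled_sum_diff: "scaled_sum (\<lambda>p. f p - g p) n = scaled_sum f n - scaled_sum g n"
  by (simp add: scaled_sum_def sum_subtractf diff_divide_distrib)

lemma scaled_sum_sum: "scaled_sum (\<lambda>p. \<Sum>i\<in>I. f i p) n = (\<Sum>i\<in>I. scaled_sum (f i) n)"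
  unfolding scaled_sum_def by (subst sum.swap) (simp add: sum_divide_distrib)

text \<open>Expanding one factor \<open>1 - p\<close> gives a difference in which the exponent
  \<open>m\<close> may rise, so \<open>m\<close> varies in the induction and the base case is a pure
  power.\<close>

lemma scaled_sum_monomial_convergent: "convergent (scaled_sum (\<lambda>p. p ^ Suc m * (1 - p) ^ r))"
proof (induction r arbitrary: m)
  case 0
  then show ?case using scaled_sum_power_tendsto[of m] by (auto simp: convergent_def)
next
  case (Suc r)
  have "(\<lambda>p::real. p ^ Suc m * (1 - p) ^ Suc r) = (\<lambda>p. p ^ Suc m * (1 - p) ^ r - p ^ Suc (Suc m) * (1 - p) ^ r)"
    by (auto simp: algebra_simps)
  then have "scaled_sum (\<lambda>p. p ^ Suc m * (1 - p) ^ Suc r) =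
      (\<lambda>n. scaled_sum (\<lambda>p. p ^ Suc m * (1 - p) ^ r) n - scaled_sum (\<lambda>p. p ^ Suc (Suc m) * (1 - p) ^ r) n)"
    using scaled_sum_diff by auto
  then show ?case using convergent_diff[OF Suc.IH[of m] Suc.IH[of "Suc m"]] by (simp only:)
qed

lemma sum_subset_weights:
  fixes p :: real
  assumes "finite A"
  shows "(\<Sum>J\<in>Pow A. p ^ card J * (1 - p) ^ (card A - card J)) = 1"
proof -
  have "(\<Sum>J\<in>Pow A. p ^ card J * (1 - p) ^ (card A - card J)) = expect A (\<lambda>_. p) (\<lambda>_. 1)"
    unfolding expect_def using assms
    by (intro sum.cong) (auto simp: card_Diff_subset finite_subset)
  then show ?thesis using assms by (simp add: expect_const)
qed

section \<open>From pattern probabilities to polynomials in one probability\<close>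

lemma part_prob_antimono: "i \<le> k \<Longrightarrow> part_prob x k \<le> part_prob x i"
  unfolding part_prob_fermi by (intro fermi_antimono divide_right_mono) auto

text \<open>Replacing each \<open>part_prob x (k - j)\<close> by \<open>part_prob x k\<close>
  changes factors of a product of numbers in \<open>[0, 1]\<close>, so the errors add. By
  monotonicity each is at most \<open>part_prob x (k - t) - part_prob x k\<close>, a form chosen
  because it telescopes in the sum over \<open>k\<close>.\<close>

lemma pattern_prob_diff_le:
  assumes "J \<subseteq> {1..t}"
  shows "\<bar>pattern_prob t J (part_prob x) k - part_prob x k ^ Suc (card J) * (1 - part_prob x k) ^ (t - card J)\<bar>
    \<le> real t * (part_prob x (k - t) - part_prob x k)"
proof -
  let ?p = "part_prob x"
  define z where "z j = (if j \<in> J then ?p (k - j) else 1 - ?p (k - j))" for j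
  define w where "w j = (if j \<in> J then ?p k else 1 - ?p k)" for j
  have fin: "finite J" using assms finite_subset by blast
  have split: "prod g {1..t} = prod g ({1..t} - J) * prod g J" for g :: "nat \<Rightarrow> real"
    using prod.subset_diff[OF assms] by simp
  have "pattern_prob t J ?p k = ?p k * (\<Prod>j=1..t. z j)"
    unfolding pattern_prob_def split by (simp add: z_def)
  moreover have "?p k ^ Suc (card J) * (1 - ?p k) ^ (t - card J) = ?p k * (\<Prod>j=1..t. w j)"
    unfolding split using assms fin by (simp add: w_def card_Diff_subset)
  ultimately have "\<bar>pattern_prob t J ?p k - ?p k ^ Suc (card J) * (1 - ?p k) ^ (t - card J)\<bar>
      = \<bar>?p k * ((\<Prod>j=1..t. z j) - (\<Prod>j=1..t. w j))\<bar>"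
    by (simp only: right_diff_distrib)
  also have "\<dots> = ?p k * \<bar>(\<Prod>j=1..t. z j) - (\<Prod>j=1..t. w j)\<bar>"
    using part_prob_bounds(1)[of x k] by (simp only: abs_mult abs_of_pos)
  also have "\<dots> \<le> 1 * \<bar>(\<Prod>j=1..t. z j) - (\<Prod>j=1..t. w j)\<bar>"
    using part_prob_bounds(2)[of x k] by (intro mult_right_mono) auto
  also have "\<dots> \<le> (\<Sum>j=1..t. \<bar>z j - w j\<bar>)"
    using norm_prod_diff[of "{1..t}" z w] part_prob_bounds[of x]
    by (auto simp: z_def w_def less_imp_le abs_le_iff intro: order_trans[of _ 0])
  also have "\<dots> \<le> (\<Sum>j=1..t. ?p (k - t) - ?p k)"
  proof (intro sum_mono)
    fix j assume j: "j \<in> {1..t}"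
    have "?p k \<le> ?p (k - j)" "?p (k - j) \<le> ?p (k - t)"
      using j by (auto intro: part_prob_antimono)
    then show "\<bar>z j - w j\<bar> \<le> ?p (k - t) - ?p k" by (auto simp: z_def w_def)
  qed
  finally show ?thesis by simp
qed

text \<open>The telescoping sum leaves at most \<open>t\<close> probabilities, giving
  \<open>t * t\<close>; the terms with \<open>k \<le> t\<close> give another \<open>t\<close>. The
  bound is uniform in \<open>n\<close> and \<open>x\<close>, hence negligible after division by
  \<open>x ^ 4\<close>.\<close>

lemma sum_pattern_prob_diff_le:
  assumes "J \<subseteq> {1..t}"
  shows "\<bar>(\<Sum>k\<in>{t<..n}. pattern_prob t J (part_prob x) k) -
      (\<Sum>k=1..n. part_prob x k ^ Suc (card J) * (1 - part_prob x k) ^ (t - card J))\<bar> \<le> (real t)\<^sup>2 + real t"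
proof -
  let ?p = "part_prob x"
  define \<rho> where "\<rho> k = ?p k ^ Suc (card J) * (1 - ?p k) ^ (t - card J)" for k
  have split: "(\<Sum>k=1..n. g k) = (\<Sum>k\<in>{1..n} \<inter> {..t}. g k) + (\<Sum>k\<in>{t<..n}. g k)" for g :: "nat \<Rightarrow> real"
    by (subst sum.union_disjoint[symmetric]) (auto intro!: sum.cong)
  have head: "0 \<le> (\<Sum>k\<in>{1..n} \<inter> {..t}. g k) \<and> (\<Sum>k\<in>{1..n} \<inter> {..t}. g k) \<le> real t"
    if "\<And>k. 0 \<le> g k \<and> g k \<le> 1" for g :: "nat \<Rightarrow> real"
  proof -
    have "card ({1..n} \<inter> {..t}) \<le> card {1..t}" by (intro card_mono) auto
    moreover have "(\<Sum>k\<in>{1..n} \<inter> {..t}. g k) \<le> real (card ({1..n} \<inter> {..t})) * 1"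
      using that by (intro sum_bounded_above) auto
    ultimately show ?thesis using that by (auto intro!: sum_nonneg)
  qed
  have "(\<Sum>k\<in>{t<..n}. ?p (k - t)) = (\<Sum>k\<in>(\<lambda>k. k - t) ` {t<..n}. ?p k)"
    by (subst sum.reindex) (auto simp: inj_on_def)
  also have "\<dots> \<le> (\<Sum>k=1..n. ?p k)"
    using part_prob_bounds(1) by (intro sum_mono2) (auto simp: less_imp_le)
  also have "\<dots> \<le> real t + (\<Sum>k\<in>{t<..n}. ?p k)"
  proof -
    have "0 \<le> ?p k \<and> ?p k \<le> 1" for k using part_prob_bounds[of x k] by simp
    from head[of ?p, OF this] show ?thesis using split[of ?p] by linarith
  qed
  finally have shift: "(\<Sum>k\<in>{t<..n}. ?p (k - t) - ?p k) \<le> real t" by (simp add: sum_subtractf)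
  have "\<bar>(\<Sum>k\<in>{t<..n}. pattern_prob t J ?p k) - (\<Sum>k\<in>{t<..n}. \<rho> k)\<bar>
      \<le> (\<Sum>k\<in>{t<..n}. real t * (?p (k - t) - ?p k))"
    unfolding sum_subtractf[symmetric] \<rho>_def
    by (intro order_trans[OF sum_abs] sum_mono pattern_prob_diff_le assms)
  also have "\<dots> \<le> real t * real t"
    unfolding sum_distrib_left[symmetric] using shift by (intro mult_left_mono) auto
  finally have 1: "\<bar>(\<Sum>k\<in>{t<..n}. pattern_prob t J ?p k) - (\<Sum>k\<in>{t<..n}. \<rho> k)\<bar> \<le> (real t)\<^sup>2"
    by (simp add: power2_eq_square)
  have "0 \<le> \<rho> k \<and> \<rho> k \<le> 1" for k
    unfolding \<rho>_def using part_prob_bounds[of x k]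
    by (intro conjI mult_nonneg_nonneg mult_le_one power_le_one zero_le_power) (auto simp: less_imp_le)
  from head[of \<rho>, OF this] 1 show ?thesis
    unfolding \<rho>_def[symmetric] split[of \<rho>] by linarith
qed

text \<open>Kept as an abstract limit: evaluation takes place only for sums over families of
  \<open>J\<close> whose weights combine to a simple polynomial in \<open>p\<close>.\<close>

definition pattern_limit :: "nat \<Rightarrow> nat set \<Rightarrow> real" where
  "pattern_limit t J = lim (scaled_sum (\<lambda>p. p ^ Suc (card J) * (1 - p) ^ (t - card J)))"

lemma scaled_sum_pattern_limit:
  "scaled_sum (\<lambda>p. p ^ Suc (card J) * (1 - p) ^ (t - card J)) \<longlonglongrightarrow> pattern_limit t J"
  unfolding pattern_limit_def by (intro convergent_LIMSEQ_iff[THEN iffD1] scaled_sum_monomial_convergent)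

lemma inverse_saddle_at: "(\<lambda>n. c / saddle_at n) \<longlonglongrightarrow> 0" "(\<lambda>n. c / saddle_at n ^ 4) \<longlonglongrightarrow> 0"
  by (intro tendsto_divide_0[OF tendsto_const] filterlim_at_top_imp_at_infinity
      filterlim_pow_at_top filterlim_saddle_at; simp)+

lemma mean_pattern_count_tendsto:
  assumes J: "J \<subseteq> {1..t}"
  shows "(\<lambda>n. mean_over n (\<lambda>S. real (pattern_count t J S)) / saddle_at n ^ 4) \<longlonglongrightarrow> pattern_limit t J"
proof -
  define \<mu> where "\<mu> n = (\<Sum>k\<in>{t<..n}. pattern_prob t J (part_prob (saddle_at n)) k)" for n
  define \<rho> where "\<rho> = scaled_sum (\<lambda>p. p ^ Suc (card J) * (1 - p) ^ (t - card J))"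
  have "(\<lambda>n. \<mu> n / saddle_at n ^ 4 - \<rho> n) \<longlonglongrightarrow> 0"
  proof (rule Lim_null_comparison)
    show "\<forall>\<^sub>F n in sequentially. norm (\<mu> n / saddle_at n ^ 4 - \<rho> n) \<le> ((real t)\<^sup>2 + real t) / saddle_at n ^ 4"
    proof (intro always_eventually allI)
      fix n
      show "norm (\<mu> n / saddle_at n ^ 4 - \<rho> n) \<le> ((real t)\<^sup>2 + real t) / saddle_at n ^ 4"
        using divide_right_mono[OF sum_pattern_prob_diff_le[OF J, where n = n and x = "saddle_at n"], of "saddle_at n ^ 4"]
        by (simp add: \<mu>_def \<rho>_def scaled_sum_def abs_divide flip: diff_divide_distrib)
    qed
  qed (rule inverse_saddle_at)
  from tendsto_add[OF this scaled_sum_pattern_limit[of J t, folded \<rho>_def]]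
  have mu: "(\<lambda>n. \<mu> n / saddle_at n ^ 4) \<longlonglongrightarrow> pattern_limit t J" by simp
  have "(\<lambda>n. mean_over n (\<lambda>S. real (pattern_count t J S)) / saddle_at n ^ 4 - \<mu> n / saddle_at n ^ 4) \<longlonglongrightarrow> 0"
  proof (rule Lim_null_comparison)
    show "\<forall>\<^sub>F n in sequentially.
        norm (mean_over n (\<lambda>S. real (pattern_count t J S)) / saddle_at n ^ 4 - \<mu> n / saddle_at n ^ 4)
        \<le> \<mu> n / saddle_at n ^ 4 * (1 / saddle_at n) + 24 * real (t + 1) / saddle_at n"
      using eventually_ge_at_top[of 12]
    proof eventually_elim
      case (elim n)
      define x where "x = saddle_at n"
      have s: "saddle n x" unfolding x_def by (rule saddle_at[OF elim])
      have x: "1 \<le> x" using s by (simp add: saddle_def)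
      have "\<bar>mean_over n (\<lambda>S. real (pattern_count t J S)) - \<mu> n\<bar> / x ^ 4 \<le>
          (\<mu> n / x + 24 * real (t + 1) * x ^ 3) / x ^ 4"
        using mean_pattern_count[OF s J] x by (intro divide_right_mono) (auto simp: \<mu>_def x_def)
      also have "\<dots> = \<mu> n / x ^ 4 * (1 / x) + 24 * real (t + 1) / x"
        using x by (simp add: add_divide_distrib power3_eq_cube power4_eq_xxxx)
      finally show ?case
        using x by (simp add: x_def[symmetric] abs_divide flip: diff_divide_distrib)
    qed
    have "(\<lambda>n. \<mu> n / saddle_at n ^ 4 * (1 / saddle_at n) + 24 * real (t + 1) / saddle_at n)
        \<longlonglongrightarrow> pattern_limit t J * 0 + 0"
      by (intro tendsto_intros mu inverse_saddle_at)
    then show "(\<lambda>n. \<mu> n / saddle_at n ^ 4 * (1 / saddle_at n) + 24 * real (t + 1) / saddle_at n) \<longlonglongrightarrow> 0"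
      by simp
  qed
  from tendsto_add[OF this mu] show ?thesis by simp
qed

section \<open>From patterns to hook counts\<close>

lemma card_window_eq_sum:
  assumes "finite S"
  shows "card {k \<in> S. t < k \<and> P (window t S k)} = (\<Sum>J | J \<subseteq> {1..t} \<and> P J. pattern_count t J S)"
proof -
  have "window t S k \<subseteq> {1..t}" for k by (auto simp: window_def)
  then have "{k \<in> S. t < k \<and> P (window t S k)} =
      (\<Union>J\<in>{J. J \<subseteq> {1..t} \<and> P J}. {k \<in> S. t < k \<and> window t S k = J})"
    by blast
  also have "card \<dots> = (\<Sum>J | J \<subseteq> {1..t} \<and> P J. card {k \<in> S. t < k \<and> window t S k = J})"
    using assms by (intro card_UN_disjoint) auto
  finally show ?thesis by (simp add: pattern_count_def)
qed

lemma mean_over_mono: "(\<And>S. S \<in> odd_sets n \<Longrightarrow> X S \<le> Y S) \<Longrightarrow> mean_over n X \<le> mean_over n Y"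
  unfolding mean_over_def by (intro divide_right_mono sum_mono) auto

text \<open>Applied with \<open>m = 2\<close> and the condition \<open>t \<notin> J\<close> for
  \<open>SC\<close>, and with \<open>m = 1\<close> and \<open>window_hook t\<close> for
  \<open>DO\<close>. The error \<open>c\<close> is bounded, so it vanishes after division by
  \<open>saddle_at n ^ 4\<close>.\<close>

lemma mean_window_count_tendsto:
  assumes "\<And>n S. S \<in> odd_sets n \<Longrightarrow> \<exists>c\<le>t. h S = m * card {k \<in> S. t < k \<and> P (window t S k)} + c"
  shows "(\<lambda>n. mean_over n (\<lambda>S. real (h S)) / saddle_at n ^ 4)
    \<longlonglongrightarrow> real m * (\<Sum>J | J \<subseteq> {1..t} \<and> P J. pattern_limit t J)"
proof (rule tendsto_sandwich)
  define X where "X n = real m * (\<Sum>J | J \<subseteq> {1..t} \<and> P J. mean_over n (\<lambda>S. real (pattern_count t J S)))" for n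
  have X: "X n = mean_over n (\<lambda>S. real (m * card {k \<in> S. t < k \<and> P (window t S k)}))" for n
  proof -
    have "X n = real m * mean_over n (\<lambda>S. real (card {k \<in> S. t < k \<and> P (window t S k)}))"
      unfolding X_def mean_over_sum[symmetric] unfolding mean_over_def
      by (simp add: card_window_eq_sum odd_setsD)
    then show ?thesis by (simp add: mean_over_def sum_distrib_left)
  qed
  have lim: "(\<lambda>n. X n / saddle_at n ^ 4) \<longlonglongrightarrow> real m * (\<Sum>J | J \<subseteq> {1..t} \<and> P J. pattern_limit t J)"
  proof -
    have "(\<lambda>n. real m * (\<Sum>J | J \<subseteq> {1..t} \<and> P J. mean_over n (\<lambda>S. real (pattern_count t J S)) / saddle_at n ^ 4))
        \<longlonglongrightarrow> real m * (\<Sum>J | J \<subseteq> {1..t} \<and> P J. pattern_limit t J)"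
      by (intro tendsto_intros mean_pattern_count_tendsto) auto
    then show ?thesis by (simp only: X_def sum_divide_distrib[symmetric] times_divide_eq_right)
  qed
  then show "(\<lambda>n. X n / saddle_at n ^ 4) \<longlonglongrightarrow> real m * (\<Sum>J | J \<subseteq> {1..t} \<and> P J. pattern_limit t J)" .
  show "(\<lambda>n. X n / saddle_at n ^ 4 + real t / saddle_at n ^ 4) \<longlonglongrightarrow> real m * (\<Sum>J | J \<subseteq> {1..t} \<and> P J. pattern_limit t J)"
    using tendsto_add[OF lim inverse_saddle_at(2)[of "real t"]] by simp
  show "\<forall>\<^sub>F n in sequentially. X n / saddle_at n ^ 4 \<le> mean_over n (\<lambda>S. real (h S)) / saddle_at n ^ 4"
    unfolding X
  proof (intro always_eventually allI divide_right_mono mean_over_mono)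
    fix n S assume "S \<in> odd_sets n"
    from assms[OF this]
    show "real (m * card {k \<in> S. t < k \<and> P (window t S k)}) \<le> real (h S)" by force
  qed simp
  show "\<forall>\<^sub>F n in sequentially.
      mean_over n (\<lambda>S. real (h S)) / saddle_at n ^ 4 \<le> X n / saddle_at n ^ 4 + real t / saddle_at n ^ 4"
    using eventually_ge_at_top[of 12]
  proof eventually_elim
    case (elim n)
    have "mean_over n (\<lambda>S. real (h S)) \<le> mean_over n (\<lambda>S. real (m * card {k \<in> S. t < k \<and> P (window t S k)}) + real t)"
    proof (rule mean_over_mono)
      fix S assume "S \<in> odd_sets n"
      from assms[OF this]
      show "real (h S) \<le> real (m * card {k \<in> S. t < k \<and> P (window t S k)}) + real t" by force
    qed
    \<comment> \<open>The mean of the constant \<open>t\<close> is \<open>t\<close> because the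
      saddle guarantees that \<open>odd_sets n\<close> is nonempty.\<close>
    also have "\<dots> = X n + real t"
      using card_odd_sets_pos[OF saddle_at[OF elim]]
      by (simp add: X mean_over_def sum.distrib add_divide_distrib)
    finally show ?case by (simp add: divide_right_mono flip: add_divide_distrib)
  qed
qed

section \<open>Values and bounds of the limits\<close>

lemma sum_pattern_limit_tendsto:
  assumes "\<And>p. (\<Sum>J\<in>\<J>. p ^ Suc (card J) * (1 - p) ^ (t - card J)) = \<phi> p"
  shows "scaled_sum \<phi> \<longlonglongrightarrow> (\<Sum>J\<in>\<J>. pattern_limit t J)"
proof -
  have "(\<lambda>n. \<Sum>J\<in>\<J>. scaled_sum (\<lambda>p. p ^ Suc (card J) * (1 - p) ^ (t - card J)) n) \<longlonglongrightarrow>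
      (\<Sum>J\<in>\<J>. pattern_limit t J)"
    by (intro tendsto_sum scaled_sum_pattern_limit)
  moreover have "\<phi> = (\<lambda>p. \<Sum>J\<in>\<J>. p ^ Suc (card J) * (1 - p) ^ (t - card J))" using assms by auto
  ultimately show ?thesis by (simp only: scaled_sum_sum[abs_def])
qed

lemma fermi_primitive_0:
  "fermi_primitive 0 0 = - ln 2" "fermi_primitive 1 0 = - ln 2 + 1 / 2"
  by (simp_all add: fermi_primitive_def fermi_def)

text \<open>With all windows allowed the weights sum to \<open>p\<close>: this is the limit for the
  number of parts, half the integral of \<open>fermi\<close> over the positive axis.\<close>

lemma sum_pattern_limit: "(\<Sum>J | J \<subseteq> {1..t}. pattern_limit t J) = ln 2 / 2"
proof (rule LIMSEQ_unique)
  show "scaled_sum (\<lambda>p. p) \<longlonglongrightarrow> (\<Sum>J | J \<subseteq> {1..t}. pattern_limit t J)"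
  proof (rule sum_pattern_limit_tendsto)
    fix p :: real
    show "(\<Sum>J | J \<subseteq> {1..t}. p ^ Suc (card J) * (1 - p) ^ (t - card J)) = p"
      using sum_subset_weights[of "{1..t}" p]
      by (simp add: Pow_def mult.assoc flip: sum_distrib_left)
  qed
  show "scaled_sum (\<lambda>p. p) \<longlonglongrightarrow> ln 2 / 2"
    using scaled_sum_power_tendsto[of 0] by (simp add: fermi_primitive_0)
qed

text \<open>Summing over the other window positions leaves \<open>p * (1 - p)\<close>, minus the
  derivative of \<open>fermi\<close>. Its integral over the positive axis is
  \<open>fermi 0 = 1 / 2\<close>, to be halved; in the proof this appears as the cancellation of
  \<open>ln 2\<close> between the primitives for the powers 1 and 2.\<close>

lemma sum_pattern_limit_not_last:
  assumes "1 \<le> t"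
  shows "(\<Sum>J | J \<subseteq> {1..t} \<and> t \<notin> J. pattern_limit t J) = 1 / 4"
proof (rule LIMSEQ_unique)
  obtain u where t: "t = Suc u" using assms by (cases t) auto
  have J: "{J. J \<subseteq> {1..t} \<and> t \<notin> J} = Pow {1..u}"
    by (auto simp: t subset_iff le_Suc_eq)
  show "scaled_sum (\<lambda>p. p * (1 - p)) \<longlonglongrightarrow> (\<Sum>J | J \<subseteq> {1..t} \<and> t \<notin> J. pattern_limit t J)"
  proof (rule sum_pattern_limit_tendsto)
    fix p :: real
    have "(\<Sum>J | J \<subseteq> {1..t} \<and> t \<notin> J. p ^ Suc (card J) * (1 - p) ^ (t - card J)) =
        (\<Sum>J\<in>Pow {1..u}. p * (1 - p) * (p ^ card J * (1 - p) ^ (u - card J)))"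
      unfolding J
    proof (intro sum.cong refl)
      fix J assume "J \<in> Pow {1..u}"
      then have "card J \<le> card {1..u}" by (intro card_mono) auto
      then show "p ^ Suc (card J) * (1 - p) ^ (t - card J) = p * (1 - p) * (p ^ card J * (1 - p) ^ (u - card J))"
        by (simp add: t Suc_diff_le)
    qed
    then show "(\<Sum>J | J \<subseteq> {1..t} \<and> t \<notin> J. p ^ Suc (card J) * (1 - p) ^ (t - card J)) = p * (1 - p)"
      using sum_subset_weights[of "{1..u}" p] by (simp flip: sum_distrib_left)
  qed
  have "(\<lambda>n. scaled_sum (\<lambda>p. p ^ Suc 0) n - scaled_sum (\<lambda>p. p ^ Suc 1) n) \<longlonglongrightarrow>
      - fermi_primitive 0 0 / 2 - - fermi_primitive 1 0 / 2"
    by (intro tendsto_intros scaled_sum_power_tendsto)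
  moreover have "- fermi_primitive 0 0 / 2 - - fermi_primitive 1 0 / 2 = 1 / 4"
    unfolding fermi_primitive_0 by (simp add: field_simps)
  moreover have "scaled_sum (\<lambda>p. p * (1 - p)) = (\<lambda>n. scaled_sum (\<lambda>p. p ^ Suc 0) n - scaled_sum (\<lambda>p. p ^ Suc 1) n)"
    unfolding scaled_sum_diff[symmetric] by (simp add: algebra_simps power2_eq_square)
  ultimately show "scaled_sum (\<lambda>p. p * (1 - p)) \<longlonglongrightarrow> 1 / 4" by (simp only:)
qed

lemma pattern_limit_nonneg: "0 \<le> pattern_limit t J"
proof (rule LIMSEQ_le_const[OF scaled_sum_pattern_limit], intro exI allI impI)
  fix n
  show "0 \<le> scaled_sum (\<lambda>p. p ^ Suc (card J) * (1 - p) ^ (t - card J)) n"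
    unfolding scaled_sum_def using part_prob_bounds
    by (intro divide_nonneg_nonneg sum_nonneg) (auto simp: less_imp_le)
qed

text \<open>The sample points are positive, so \<open>p \<le> 1 / 2\<close> and
  \<open>p * (1 - p) ^ t\<close> is at least \<open>p / 2 ^ t\<close>. This keeps the limit for
  \<open>DO\<close> away from 0, so that the quotient converges.\<close>

lemma pattern_limit_empty_pos: "0 < pattern_limit t {}"
proof -
  have "(1 / 2) ^ t * (ln 2 / 2) \<le> pattern_limit t {}"
  proof (rule LIMSEQ_le)
    have "(\<lambda>n. (1 / 2) ^ t * scaled_sum (\<lambda>p. p ^ Suc 0) n) \<longlonglongrightarrow> (1 / 2) ^ t * (- fermi_primitive 0 0 / 2)"
      by (intro tendsto_intros scaled_sum_power_tendsto)
    then show "(\<lambda>n. (1 / 2) ^ t * scaled_sum (\<lambda>p. p) n) \<longlonglongrightarrow> (1 / 2) ^ t * (ln 2 / 2)"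
      by (simp add: fermi_primitive_0)
    show "scaled_sum (\<lambda>p. p ^ Suc (card ({} :: nat set)) * (1 - p) ^ (t - card ({} :: nat set))) \<longlonglongrightarrow> pattern_limit t {}"
      by (rule scaled_sum_pattern_limit)
    show "\<exists>N. \<forall>n\<ge>N. (1 / 2) ^ t * scaled_sum (\<lambda>p. p) n \<le>
        scaled_sum (\<lambda>p. p ^ Suc (card ({} :: nat set)) * (1 - p) ^ (t - card ({} :: nat set))) n"
    proof (intro exI allI impI)
      fix n
      have "(1 / 2) ^ t * part_prob x k \<le> part_prob x k * (1 - part_prob x k) ^ t" if "k \<in> {1..n}" for x k
      proof -
        have "part_prob x k \<le> fermi 0"
          unfolding part_prob_fermi using that by (intro fermi_antimono) auto
        then have "1 / 2 \<le> 1 - part_prob x k" by (simp add: fermi_def)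
        then have "(1 / 2) ^ t \<le> (1 - part_prob x k) ^ t" by (intro power_mono) auto
        then show ?thesis using part_prob_bounds(1)[of x k] by (simp add: mult.commute mult_left_mono)
      qed
      then show "(1 / 2) ^ t * scaled_sum (\<lambda>p. p) n \<le>
          scaled_sum (\<lambda>p. p ^ Suc (card ({} :: nat set)) * (1 - p) ^ (t - card ({} :: nat set))) n"
        unfolding scaled_sum_def times_divide_eq_right sum_distrib_left
        by (intro divide_right_mono sum_mono) auto
    qed
  qed
  moreover have "0 < (1 / 2) ^ t * (ln 2 / 2 :: real)" by simp
  ultimately show ?thesis by linarith
qed

text \<open>Both sides are 0 when \<open>odd_sets n\<close> is empty, so the identity holds for
  every \<open>n\<close>. The factor \<open>card (odd_sets n)\<close> is shared with
  \<open>b_star\<close> and cancels in the quotient.\<close>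

lemma a_star_eq: "real (a_star t n) = real (card (odd_sets n)) * mean_over n (\<lambda>S. real (hook_count t (nest_hooks (desc S))))"
  unfolding a_star_def mean_over_def
  by (subst sum.reindex_bij_betw[OF bij_betw_SC, symmetric]) (auto simp: card_eq_0_iff finite_odd_sets)

lemma b_star_eq: "real (b_star t n) = real (card (odd_sets n)) * mean_over n (\<lambda>S. real (hook_count t (map (\<lambda>k. 2 * k - 1) (desc S))))"
  unfolding b_star_def mean_over_def
  by (subst sum.reindex_bij_betw[OF bij_betw_DO, symmetric]) (auto simp: card_eq_0_iff finite_odd_sets)

theorem theorem1p2:
  fixes t :: nat
  assumes "t \<ge> 2"
  shows "(\<exists>N::nat. \<forall>n>N. a_star t n \<ge> b_star t n) \<and>
         (\<exists>\<gamma>::real. \<gamma> > 1 \<and> (\<lambda>n. real (a_star t n) / real (b_star t n)) \<longlonglongrightarrow> \<gamma>)"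
proof -
  define A where "A n = mean_over n (\<lambda>S. real (hook_count t (nest_hooks (desc S)))) / saddle_at n ^ 4" for n
  define B where "B n = mean_over n (\<lambda>S. real (hook_count t (map (\<lambda>k. 2 * k - 1) (desc S)))) / saddle_at n ^ 4" for n
  define \<beta> where "\<beta> = (\<Sum>J | J \<subseteq> {1..t} \<and> window_hook t J. pattern_limit t J)"
  have A: "A \<longlonglongrightarrow> real 2 * (\<Sum>J | J \<subseteq> {1..t} \<and> t \<notin> J. pattern_limit t J)"
    unfolding A_def[abs_def]
  proof (rule mean_window_count_tendsto)
    fix n S assume S: "S \<in> odd_sets n"
    then have "finite S" "0 \<notin> S" by (auto simp: odd_sets_def)
    then show "\<exists>c\<le>t. hook_count t (nest_hooks (desc S)) =
        2 * card {k \<in> S. t < k \<and> t \<notin> window t S k} + c"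
      using hook_count_nest_hooks[OF strict_pos_desc, of S t] assms by (simp add: desc window_def)
  qed
  have B: "B \<longlonglongrightarrow> real 1 * \<beta>"
    unfolding B_def[abs_def] \<beta>_def
  proof (rule mean_window_count_tendsto)
    fix n S assume S: "S \<in> odd_sets n"
    then have "finite S" "0 \<notin> S" by (auto simp: odd_sets_def)
    then show "\<exists>c\<le>t. hook_count t (map (\<lambda>k. 2 * k - 1) (desc S)) =
        1 * card {k \<in> S. t < k \<and> window_hook t (window t S k)} + c"
      using hook_count_odd_parts[of S _ t] by simp
  qed
  \<comment> \<open>The gap to \<open>1 / 2\<close> is strict, and hence
    \<open>\<gamma> > 1\<close>, because \<open>ln 2 < 1\<close>.\<close>
  have "\<beta> \<le> (\<Sum>J | J \<subseteq> {1..t}. pattern_limit t J)"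
    unfolding \<beta>_def using pattern_limit_nonneg by (intro sum_mono2) auto
  then have "\<beta> < 1 / 2" using ln_2_less_1 sum_pattern_limit[of t] by linarith
  \<comment> \<open>The empty window admits the hook with \<open>d = t\<close> and leg 0.\<close>
  have "pattern_limit t {} \<le> \<beta>"
    unfolding \<beta>_def using assms pattern_limit_nonneg
    by (intro member_le_sum) (auto simp: window_hook_def)
  then have "0 < \<beta>" using pattern_limit_empty_pos[of t] by linarith
  have "(\<lambda>n. A n / B n) \<longlonglongrightarrow> (1 / 2) / \<beta>"
  proof -
    have "1 \<le> t" using assms by simp
    from tendsto_divide[OF A B] show ?thesis
      using \<open>0 < \<beta>\<close> unfolding sum_pattern_limit_not_last[OF \<open>1 \<le> t\<close>] by simp
  qed
  moreover have "\<forall>\<^sub>F n in sequentially. A n / B n = real (a_star t n) / real (b_star t n)"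
    using eventually_ge_at_top[of 12]
  proof eventually_elim
    case (elim n)
    have "saddle n (saddle_at n)" by (rule saddle_at[OF elim])
    then have "0 < saddle_at n" "0 < card (odd_sets n)"
      using card_odd_sets_pos by (auto simp: saddle_def)
    then show ?case by (simp add: A_def B_def a_star_eq b_star_eq)
  qed
  ultimately have lim: "(\<lambda>n. real (a_star t n) / real (b_star t n)) \<longlonglongrightarrow> (1 / 2) / \<beta>"
    by (rule Lim_transform_eventually)
  have gt: "1 < (1 / 2) / \<beta>" using \<open>0 < \<beta>\<close> \<open>\<beta> < 1 / 2\<close> by (simp add: field_simps)
  have "\<forall>\<^sub>F n in sequentially. 1 < real (a_star t n) / real (b_star t n)"
    using order_tendstoD(1)[OF lim gt] .
  then obtain N where N: "\<And>n. N \<le> n \<Longrightarrow> 1 < real (a_star t n) / real (b_star t n)"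
    by (auto simp: eventually_sequentially)
  have "b_star t n \<le> a_star t n" if "N < n" for n
    using N[of n] that by (cases "b_star t n = 0") (auto simp: field_simps)
  then show ?thesis using lim gt by blast
qed

end
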